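(* Let $k\ge1$ be an integer and let $x_0,x_1,\ldots,x_{3k+1}\in\mathbb{Q}$ be pairwise distinct. Let $W\subset\mathbb{P}^{3k+1}$, with homogeneous coordinates $(Y_0,\ldots,Y_{3k+1})$, be the intersection of the $k+1$ diagonal quadrics $$\det\begin{pmatrix}1&1&\cdots&1&1\\ x_0&x_1&\cdots&x_{2k}&x_i\\ \vdots&\vdots&&\vdots&\vdots\\ x_0^{2k}&x_1^{2k}&\cdots&x_{2k}^{2k}&x_i^{2k}\\ Y_0^2&Y_1^2&\cdots&Y_{2k}^2&Y_i^2\end{pmatrix}=0,\qquad i=2k+1,\ldots,3k+1.$$ Then $W$ is rational.
   Context: The determinants are $(2k+2)\times(2k+2)$ determinants whose columns are $(1,x_j,\ldots,x_j^{2k},Y_j^2)^T$ for $j=0,\ldots,2k$ and $j=i$. A variety is called rational if it is $\mathbb{Q}$-birational to $\mathbb{P}^m$ for some $m\ge1$. *)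

theory Defs
  imports
    Complex_Main
    "HOL-Library.Poly_Mapping"
    "Jordan_Normal_Form.Determinant"
begin

text \<open>
  Projective varieties over \<open>\<rat>\<close> in the classical language: a subvariety of
  \<open>\<bbbP>\<^sup>n\<close> is identified with its set of complex points, while closed sets, density and
  rational maps are always given by homogeneous polynomials with \<^emph>\<open>rational\<close> coefficients.
  (Every scheme-theoretic point of a \<open>\<rat>\<close>-variety is the image of a complex point, so this is the
  topology of the \<open>\<rat>\<close>-scheme.)
\<close>

type_synonym qpoly = "(nat \<Rightarrow>\<^sub>0 nat) \<Rightarrow>\<^sub>0 rat"

definition pconst :: "rat \<Rightarrow> qpoly" where
  "pconst c = Poly_Mapping.single 0 c"

definition pvar :: "nat \<Rightarrow> qpoly" where
  "pvar i = Poly_Mapping.single (Poly_Mapping.single i 1) 1"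

definition peval :: "qpoly \<Rightarrow> (nat \<Rightarrow> complex) \<Rightarrow> complex" where
  "peval p v = (\<Sum>m\<in>Poly_Mapping.keys p. of_rat (Poly_Mapping.lookup p m) *
                 (\<Prod>i\<in>Poly_Mapping.keys m. v i ^ Poly_Mapping.lookup m i))"

text \<open>Homogeneous of degree \<open>d\<close> in the variables \<open>0, \<dots>, n\<close>; the zero polynomial has every degree.\<close>

definition is_form :: "nat \<Rightarrow> nat \<Rightarrow> qpoly \<Rightarrow> bool" where
  "is_form n d p \<longleftrightarrow> (\<forall>m\<in>Poly_Mapping.keys p. Poly_Mapping.keys m \<subseteq> {..n} \<and>
                        (\<Sum>i\<in>Poly_Mapping.keys m. Poly_Mapping.lookup m i) = d)"

type_synonym ppoint = "(nat \<Rightarrow> complex) set"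

text \<open>A point is the class of its homogeneous coordinate vectors; coordinates beyond \<open>n\<close> are \<open>0\<close>.\<close>

definition hvec :: "nat \<Rightarrow> (nat \<Rightarrow> complex) set" where
  "hvec n = {v. (\<exists>i. v i \<noteq> 0) \<and> (\<forall>i>n. v i = 0)}"

definition ppoint_of :: "(nat \<Rightarrow> complex) \<Rightarrow> ppoint" where
  "ppoint_of v = {w. \<exists>c. c \<noteq> 0 \<and> w = (\<lambda>i. c * v i)}"

definition proj_space :: "nat \<Rightarrow> ppoint set" where
  "proj_space n = ppoint_of ` hvec n"

definition zero_locus :: "nat \<Rightarrow> qpoly set \<Rightarrow> ppoint set" where
  "zero_locus n S = {P \<in> proj_space n. \<forall>f\<in>S. \<forall>v\<in>P. peval f v = 0}"

definition proj_closed :: "nat \<Rightarrow> ppoint set \<Rightarrow> bool" where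
  "proj_closed n Z \<longleftrightarrow> (\<exists>S. (\<forall>f\<in>S. \<exists>d. is_form n d f) \<and> Z = zero_locus n S)"

definition proj_dense_in :: "nat \<Rightarrow> ppoint set \<Rightarrow> ppoint set \<Rightarrow> bool" where
  "proj_dense_in n D X \<longleftrightarrow> D \<subseteq> X \<and> (\<forall>Z. proj_closed n Z \<and> D \<subseteq> Z \<longrightarrow> X \<subseteq> Z)"

text \<open>
  A rational map to \<open>\<bbbP>\<^sup>m\<close> is represented by a tuple \<open>(F 0 : \<dots> : F m)\<close> of forms of the same degree;
  it is defined where they do not vanish simultaneously. In \<open>map_app\<close> all representatives of \<open>P\<close>
  yield the same point, so the union is that point.
\<close>

definition map_vec :: "nat \<Rightarrow> (nat \<Rightarrow> qpoly) \<Rightarrow> (nat \<Rightarrow> complex) \<Rightarrow> nat \<Rightarrow> complex" where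
  "map_vec m F v = (\<lambda>j. if j \<le> m then peval (F j) v else 0)"

definition map_dom :: "nat \<Rightarrow> (nat \<Rightarrow> qpoly) \<Rightarrow> ppoint set \<Rightarrow> ppoint set" where
  "map_dom m F X = {P \<in> X. \<forall>v\<in>P. map_vec m F v \<in> hvec m}"

definition map_app :: "nat \<Rightarrow> (nat \<Rightarrow> qpoly) \<Rightarrow> ppoint \<Rightarrow> ppoint" where
  "map_app m F P = (\<Union>v\<in>P. ppoint_of (map_vec m F v))"

definition rational_map :: "nat \<Rightarrow> ppoint set \<Rightarrow> nat \<Rightarrow> ppoint set \<Rightarrow> (nat \<Rightarrow> qpoly) \<Rightarrow> bool" where
  "rational_map n X m Y F \<longleftrightarrow>
     (\<exists>d. \<forall>j\<le>m. is_form n d (F j)) \<and>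
     proj_dense_in n (map_dom m F X) X \<and>
     (\<forall>P\<in>map_dom m F X. map_app m F P \<in> Y)"

text \<open>The composite \<open>G \<circ> F\<close> is defined on a dense subset of \<open>X\<close> and is the identity there.\<close>

definition left_inverse_map ::
  "nat \<Rightarrow> ppoint set \<Rightarrow> nat \<Rightarrow> ppoint set \<Rightarrow> (nat \<Rightarrow> qpoly) \<Rightarrow> (nat \<Rightarrow> qpoly) \<Rightarrow> bool" where
  "left_inverse_map n X m Y G F \<longleftrightarrow>
     proj_dense_in n {P \<in> map_dom m F X. map_app m F P \<in> map_dom n G Y} X \<and>
     (\<forall>P\<in>map_dom m F X. map_app m F P \<in> map_dom n G Y \<longrightarrow> map_app n G (map_app m F P) = P)"

definition birational :: "nat \<Rightarrow> ppoint set \<Rightarrow> nat \<Rightarrow> ppoint set \<Rightarrow> bool" where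
  "birational n X m Y \<longleftrightarrow>
     (\<exists>F G. rational_map n X m Y F \<and> rational_map m Y n X G \<and>
            left_inverse_map n X m Y G F \<and> left_inverse_map m Y n X F G)"

text \<open>
  The maps of a birational equivalence restrict to inverse homeomorphisms between dense open subsets,
  and \<open>\<bbbP>\<^sup>m\<close> is irreducible; so a rational \<open>X\<close> is nonempty and irreducible.
\<close>

definition rational_variety :: "nat \<Rightarrow> ppoint set \<Rightarrow> bool" where
  "rational_variety n X \<longleftrightarrow> proj_closed n X \<and> (\<exists>m\<ge>1. birational n X m (proj_space m))"

definition quadric :: "nat \<Rightarrow> (nat \<Rightarrow> rat) \<Rightarrow> nat \<Rightarrow> qpoly" where
  "quadric k x i = det (mat (2*k+2) (2*k+2) (\<lambda>(r, c).
     let j = (if c \<le> 2*k then c else i)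
     in if r \<le> 2*k then pconst (x j ^ r) else pvar j ^ 2))"

definition quadric_intersection :: "nat \<Rightarrow> (nat \<Rightarrow> rat) \<Rightarrow> ppoint set" where
  "quadric_intersection k x = zero_locus (3*k+1) (quadric k x ` {2*k+1..3*k+1})"

end

theory Submission
  imports Defs
begin

text \<open>
  A point \<open>Y\<close> lies on \<open>W\<close> iff \<open>Y\<^sub>j\<^sup>2 = p (x\<^sub>j)\<close> for a polynomial \<open>p\<close> of degree at most \<open>2k\<close>. Hence
  \<open>W\<close> contains the \<open>k\<close>-plane \<open>L\<close> of all \<open>(q (x\<^sub>j))\<close> with \<open>q\<close> of degree at most \<open>k\<close>. A general
  \<open>(k+1)\<close>-plane through \<open>L\<close> meets each of the \<open>k+1\<close> quadrics in \<open>L\<close> and one further hyperplane,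
  and these hyperplanes meet in one point; so the projection from \<open>L\<close> onto \<open>\<bbbP>\<^sup>2\<^sup>k\<close> is birational,
  with inverse given by Cramer's rule for a \<open>(k+1) \<times> (k+1)\<close> matrix of linear forms.

  The open set where its determinant does not vanish is dense in \<open>W\<close>: there is one \<open>p\<close> such that
  the determinant is nonzero at all \<open>Y\<close> over \<open>p\<close>, so the norm of the determinant along the segment
  from the polynomial of an arbitrary point of \<open>W\<close> to \<open>p\<close> is a nonzero polynomial in the parameter.
\<close>

section \<open>Evaluation of forms and rational maps\<close>

text \<open>Nothing is known in advance about the components of W, and density has to be shown at
  each of its points. What helps is that the squares of the coordinates range over a linear space: a
  segment between two polynomials stays inside it, and every choice of square roots over it
  satisfies the equations of W. A single fibre that misses the determinant then serves all points at
  once. The sizes fit because the square of a polynomial of degree k has degree 2k: in the equations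
  for \<open>Y + q\<close> the part quadratic in \<open>q\<close> drops out, and k+1 linear
  equations remain for the k+1 coefficients of \<open>q\<close>. The special p comes from the order
  of the rationals. It is a product of 2k linear factors whose signs at the nodes make some square
  roots real and others imaginary, in a pattern that no polynomial of degree at most k can have at
  real nodes.\<close>

definition mon_eval :: "(nat \<Rightarrow>\<^sub>0 nat) \<Rightarrow> (nat \<Rightarrow> complex) \<Rightarrow> complex" where
  "mon_eval m v = (\<Prod>i\<in>Poly_Mapping.keys m. v i ^ Poly_Mapping.lookup m i)"

lemma mon_eval_superset:
  assumes "finite A" "Poly_Mapping.keys m \<subseteq> A"
  shows "mon_eval m v = (\<Prod>i\<in>A. v i ^ Poly_Mapping.lookup m i)"
  unfolding mon_eval_def
  by (rule prod.mono_neutral_left) (use assms in \<open>auto simp: in_keys_iff\<close>)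

lemma mon_eval_add: "mon_eval (a + b) v = mon_eval a v * mon_eval b v"
proof -
  let ?A = "Poly_Mapping.keys a \<union> Poly_Mapping.keys b"
  have "mon_eval (a + b) v = (\<Prod>i\<in>?A. v i ^ Poly_Mapping.lookup (a + b) i)"
    by (rule mon_eval_superset) (use keys_add[of a b] in auto)
  also have "\<dots> = mon_eval a v * mon_eval b v"
    by (subst (1 2) mon_eval_superset[of ?A])
      (auto simp: lookup_add power_add prod.distrib)
  finally show ?thesis .
qed

lemma peval_superset:
  assumes "finite A" "Poly_Mapping.keys p \<subseteq> A"
  shows "peval p v = (\<Sum>m\<in>A. of_rat (Poly_Mapping.lookup p m) * mon_eval m v)"
  unfolding peval_def mon_eval_def[symmetric]
  by (rule sum.mono_neutral_left) (use assms in \<open>auto simp: in_keys_iff\<close>)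

lemma peval_add: "peval (p + q) v = peval p v + peval q v"
proof -
  let ?A = "Poly_Mapping.keys p \<union> Poly_Mapping.keys q"
  have "peval (p + q) v = (\<Sum>m\<in>?A. of_rat (Poly_Mapping.lookup (p + q) m) * mon_eval m v)"
    by (rule peval_superset) (use keys_add[of p q] in auto)
  also have "\<dots> = peval p v + peval q v"
    by (subst (1 2) peval_superset[of ?A])
      (auto simp: lookup_add of_rat_add distrib_right sum.distrib)
  finally show ?thesis .
qed

lemma peval_zero [simp]: "peval 0 v = 0"
  by (simp add: peval_def)

lemma peval_single: "peval (Poly_Mapping.single m c) v = of_rat c * mon_eval m v"
  by (subst peval_superset[of "{m}"]) auto

lemma peval_sum: "peval (sum f A) v = (\<Sum>a\<in>A. peval (f a) v)"
  by (induction A rule: infinite_finite_induct) (auto simp: peval_add)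

lemma qpoly_sum_singles:
  fixes p :: qpoly
  shows "p = (\<Sum>m\<in>Poly_Mapping.keys p. Poly_Mapping.single m (Poly_Mapping.lookup p m))"
  by (rule poly_mapping_eqI) (auto simp: lookup_sum lookup_single when_def in_keys_iff sum.delta')

lemma peval_mult: "peval (p * q) v = peval p v * peval q v"
proof -
  let ?P = "Poly_Mapping.keys p" and ?Q = "Poly_Mapping.keys q"
  let ?a = "Poly_Mapping.lookup p" and ?b = "Poly_Mapping.lookup q"
  have "p * q = (\<Sum>m\<in>?P. Poly_Mapping.single m (?a m)) * (\<Sum>m\<in>?Q. Poly_Mapping.single m (?b m))"
    using qpoly_sum_singles[of p] qpoly_sum_singles[of q] by simp
  also have "\<dots> = (\<Sum>m\<in>?P. \<Sum>n\<in>?Q. Poly_Mapping.single (m + n) (?a m * ?b n))"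
    by (simp add: sum_product mult_single)
  finally have "peval (p * q) v =
      (\<Sum>m\<in>?P. \<Sum>n\<in>?Q. of_rat (?a m) * mon_eval m v * (of_rat (?b n) * mon_eval n v))"
    by (simp add: peval_sum peval_single mon_eval_add of_rat_mult mult_ac)
  also have "\<dots> = peval p v * peval q v"
    by (simp add: peval_def mon_eval_def sum_product)
  finally show ?thesis .
qed

lemma peval_pconst [simp]: "peval (pconst c) v = of_rat c"
  by (simp add: pconst_def peval_single mon_eval_def)

lemma peval_pvar [simp]: "peval (pvar i) v = v i"
  by (simp add: pvar_def peval_single mon_eval_def)

lemma peval_one [simp]: "peval 1 v = 1"
  using peval_pconst[of 1 v] by (simp add: pconst_def)

text \<open>Lets evaluation pass through \<open>det\<close> and matrix products, so that identities
  between forms become identities of complex matrices.\<close>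

interpretation peval_hom: comm_ring_hom "\<lambda>p. peval p v" for v
  by unfold_locales (auto simp: peval_add peval_mult)

text \<open>Summing exponents over the fixed range \<open>{..n}\<close> instead of the support makes
  the degree additive in the monomial.\<close>

lemma is_form_alt:
  "is_form n d p \<longleftrightarrow> (\<forall>m\<in>Poly_Mapping.keys p. Poly_Mapping.keys m \<subseteq> {..n} \<and>
                        (\<Sum>i\<le>n. Poly_Mapping.lookup m i) = d)"
proof -
  have "(\<Sum>i\<in>Poly_Mapping.keys m. Poly_Mapping.lookup m i) = (\<Sum>i\<le>n. Poly_Mapping.lookup m i)"
    if "Poly_Mapping.keys m \<subseteq> {..n}" for m :: "nat \<Rightarrow>\<^sub>0 nat"
    by (rule sum.mono_neutral_left) (use that in \<open>auto simp: in_keys_iff\<close>)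
  then show ?thesis unfolding is_form_def by metis
qed

lemma is_form_zero: "is_form n d 0"
  by (simp add: is_form_def)

lemma is_form_add: "is_form n d p \<Longrightarrow> is_form n d q \<Longrightarrow> is_form n d (p + q)"
  unfolding is_form_def using keys_add[of p q] by blast

lemma is_form_uminus: "is_form n d p \<Longrightarrow> is_form n d (- p)"
  unfolding is_form_def by simp

lemma is_form_diff: "is_form n d p \<Longrightarrow> is_form n d q \<Longrightarrow> is_form n d (p - q)"
  using is_form_add[of n d p "- q"] is_form_uminus by simp

lemma is_form_mult:
  assumes "is_form n d p" "is_form n e q"
  shows "is_form n (d + e) (p * q)"
  unfolding is_form_alt
proof
  fix m assume "m \<in> Poly_Mapping.keys (p * q)"
  then obtain a b where ab: "m = a + b" "a \<in> Poly_Mapping.keys p" "b \<in> Poly_Mapping.keys q"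
    using keys_mult[of p q] by auto
  have "Poly_Mapping.keys m \<subseteq> {..n}"
    using ab assms keys_add[of a b] unfolding is_form_alt by blast
  then show "Poly_Mapping.keys m \<subseteq> {..n} \<and> (\<Sum>i\<le>n. Poly_Mapping.lookup m i) = d + e"
    using ab assms unfolding is_form_alt by (auto simp: lookup_add sum.distrib)
qed

lemma is_form_pconst: "is_form n 0 (pconst c)"
  by (auto simp: is_form_def pconst_def)

lemma is_form_one: "is_form n 0 1"
  using is_form_pconst[of n 1] by (simp add: pconst_def)

lemma is_form_pvar: "i \<le> n \<Longrightarrow> is_form n 1 (pvar i)"
  by (auto simp: is_form_def pvar_def)

lemma is_form_sum: "(\<And>a. a \<in> A \<Longrightarrow> is_form n d (f a)) \<Longrightarrow> is_form n d (sum f A)"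
  by (induction A rule: infinite_finite_induct) (auto simp: is_form_zero is_form_add)

lemma is_form_prod:
  "(\<And>a. a \<in> A \<Longrightarrow> is_form n (d a) (f a)) \<Longrightarrow> is_form n (sum d A) (prod f A)"
  by (induction A rule: infinite_finite_induct) (auto simp: is_form_one is_form_mult)

lemma is_form_signof: "is_form n d p \<Longrightarrow> is_form n d (signof s * p)"
  by (cases s rule: sign_cases) (auto simp: is_form_uminus)

text \<open>Each Leibniz term takes one entry from every row, so the row degrees add up. They may
  differ from row to row: \<open>quadric\<close> has constant rows and one row of squares.\<close>

lemma is_form_det:
  assumes A: "A \<in> carrier_mat N N"
    and entries: "\<And>r c. r < N \<Longrightarrow> c < N \<Longrightarrow> is_form n (d r) (A $$ (r, c))"
  shows "is_form n (\<Sum>r<N. d r) (det A)"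
  unfolding det_def'[OF A]
proof (intro is_form_sum is_form_signof)
  fix s assume "s \<in> {s. s permutes {0..<N}}"
  then have "s r < N" if "r < N" for r
    using that permutes_in_image[of s "{0..<N}" r] by auto
  then show "is_form n (\<Sum>r<N. d r) (\<Prod>r = 0..<N. A $$ (r, s r))"
    unfolding lessThan_atLeast0 by (intro is_form_prod) (auto intro: entries)
qed

lemma is_form_adj_mat:
  assumes A: "A \<in> carrier_mat N N" and ij: "i < N" "j < N"
    and entries: "\<And>r c. r < N \<Longrightarrow> c < N \<Longrightarrow> is_form n d (A $$ (r, c))"
  shows "is_form n ((N - 1) * d) (adj_mat A $$ (i, j))"
proof -
  have "is_form n (\<Sum>r<N-1. d) (det (mat_delete A j i))"
  proof (rule is_form_det)
    show "mat_delete A j i \<in> carrier_mat (N - 1) (N - 1)"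
      using A by (rule mat_delete_carrier)
    fix r c assume "r < N - 1" "c < N - 1"
    then show "is_form n d (mat_delete A j i $$ (r, c))"
      using A by (auto simp: mat_delete_def intro!: entries)
  qed
  moreover have "is_form n 0 ((-1) ^ (j + i))"
    by (cases "even (j + i)") (auto simp: is_form_one is_form_uminus)
  ultimately have "is_form n (0 + (N - 1) * d) ((-1) ^ (j + i) * det (mat_delete A j i))"
    by (intro is_form_mult) auto
  then show ?thesis using A ij by (simp add: adj_mat_def cofactor_def)
qed

lemma peval_cong:
  assumes "is_form n d f" "\<And>i. i \<le> n \<Longrightarrow> v i = w i"
  shows "peval f v = peval f w"
proof -
  have "mon_eval m v = mon_eval m w" if "m \<in> Poly_Mapping.keys f" for m
    unfolding mon_eval_def
  proof (intro prod.cong refl)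
    fix i assume "i \<in> Poly_Mapping.keys m"
    then have "i \<le> n" using assms(1) that by (auto simp: is_form_def)
    then show "v i ^ Poly_Mapping.lookup m i = w i ^ Poly_Mapping.lookup m i"
      by (simp add: assms(2))
  qed
  then show ?thesis by (simp add: peval_def mon_eval_def[symmetric])
qed

lemma peval_homogeneous:
  assumes "is_form n d f"
  shows "peval f (\<lambda>i. c * v i) = c ^ d * peval f v"
proof -
  have "mon_eval m (\<lambda>i. c * v i) = c ^ d * mon_eval m v" if "m \<in> Poly_Mapping.keys f" for m
    using assms that
    by (auto simp: is_form_def mon_eval_def power_mult_distrib prod.distrib power_sum)
  then show ?thesis
    by (simp add: peval_def mon_eval_def[symmetric] sum_distrib_left mult_ac)
qed

section \<open>Projective points and rational maps through one representative\<close>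

lemma ppoint_of_iff: "w \<in> ppoint_of v \<longleftrightarrow> (\<exists>c. c \<noteq> 0 \<and> w = (\<lambda>i. c * v i))"
  by (simp add: ppoint_of_def)

lemma ppoint_of_self [simp]: "v \<in> ppoint_of v"
  unfolding ppoint_of_iff by (rule exI[of _ 1]) simp

lemma ppoint_of_scale:
  assumes "c \<noteq> 0"
  shows "ppoint_of (\<lambda>i. c * v i) = ppoint_of v"
proof (rule Set.set_eqI)
  fix w
  show "w \<in> ppoint_of (\<lambda>i. c * v i) \<longleftrightarrow> w \<in> ppoint_of v"
  proof
    assume "w \<in> ppoint_of (\<lambda>i. c * v i)"
    then obtain a where "a \<noteq> 0" "w = (\<lambda>i. a * (c * v i))" unfolding ppoint_of_iff by blast
    then show "w \<in> ppoint_of v" unfolding ppoint_of_iff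
      using assms by (intro exI[of _ "a * c"]) (auto simp: mult_ac)
  next
    assume "w \<in> ppoint_of v"
    then obtain a where "a \<noteq> 0" "w = (\<lambda>i. a * v i)" unfolding ppoint_of_iff by blast
    then show "w \<in> ppoint_of (\<lambda>i. c * v i)" unfolding ppoint_of_iff
      using assms by (intro exI[of _ "a / c"]) (auto simp: mult_ac)
  qed
qed

lemma hvec_scale: "c \<noteq> 0 \<Longrightarrow> v \<in> hvec n \<Longrightarrow> (\<lambda>i. c * v i) \<in> hvec n"
  by (auto simp: hvec_def)

lemma ppoint_of_mem_zero_locus:
  assumes "v \<in> hvec n" and forms: "\<And>f. f \<in> S \<Longrightarrow> \<exists>d. is_form n d f"
  shows "ppoint_of v \<in> zero_locus n S \<longleftrightarrow> (\<forall>f\<in>S. peval f v = 0)"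
proof
  assume "ppoint_of v \<in> zero_locus n S"
  then show "\<forall>f\<in>S. peval f v = 0" by (auto simp: zero_locus_def)
next
  assume *: "\<forall>f\<in>S. peval f v = 0"
  have "peval f w = 0" if f: "f \<in> S" and w: "w \<in> ppoint_of v" for f w
  proof -
    obtain d where "is_form n d f" using forms f by blast
    then show ?thesis using w * f by (auto simp: ppoint_of_iff peval_homogeneous)
  qed
  then show "ppoint_of v \<in> zero_locus n S"
    using assms(1) by (auto simp: zero_locus_def proj_space_def)
qed

lemma map_vec_scale:
  assumes "\<And>j. j \<le> m \<Longrightarrow> is_form n d (F j)"
  shows "map_vec m F (\<lambda>i. c * v i) = (\<lambda>j. c ^ d * map_vec m F v j)"
  using peval_homogeneous[OF assms] by (auto simp: map_vec_def fun_eq_iff)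

lemma map_app_ppoint_of:
  assumes "\<And>j. j \<le> m \<Longrightarrow> is_form n d (F j)"
  shows "map_app m F (ppoint_of v) = ppoint_of (map_vec m F v)"
proof -
  have "ppoint_of (map_vec m F w) = ppoint_of (map_vec m F v)" if w: "w \<in> ppoint_of v" for w
  proof -
    obtain c where "c \<noteq> 0" "w = (\<lambda>i. c * v i)" using w unfolding ppoint_of_iff by blast
    moreover have "map_vec m F (\<lambda>i. c * v i) = (\<lambda>j. c ^ d * map_vec m F v j)"
      by (rule map_vec_scale) (rule assms)
    ultimately show ?thesis using ppoint_of_scale[of "c ^ d" "map_vec m F v"] by simp
  qed
  then have "map_app m F (ppoint_of v) = (\<Union>w\<in>ppoint_of v. ppoint_of (map_vec m F v))"
    unfolding map_app_def by (rule SUP_cong[OF refl])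
  moreover have "ppoint_of v \<noteq> {}" using ppoint_of_self[of v] by (rule ex_in_conv[THEN iffD1, OF exI])
  ultimately show ?thesis by simp
qed

lemma ppoint_of_mem_map_dom:
  assumes "\<And>j. j \<le> m \<Longrightarrow> is_form n d (F j)"
  shows "ppoint_of v \<in> map_dom m F X \<longleftrightarrow> ppoint_of v \<in> X \<and> map_vec m F v \<in> hvec m"
proof -
  have "map_vec m F w \<in> hvec m" if w: "w \<in> ppoint_of v" "map_vec m F v \<in> hvec m" for w
  proof -
    obtain c where "c \<noteq> 0" "w = (\<lambda>i. c * v i)" using w(1) unfolding ppoint_of_iff by blast
    moreover have "map_vec m F (\<lambda>i. c * v i) = (\<lambda>j. c ^ d * map_vec m F v j)"
      by (rule map_vec_scale) (rule assms)
    ultimately show ?thesis using hvec_scale[of "c ^ d" "map_vec m F v"] w(2) by simp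
  qed
  then show ?thesis by (auto simp: map_dom_def)
qed

text \<open>A closed set containing \<open>D\<close> is cut out by forms vanishing on
  \<open>D\<close>, so density can be tested one form at a time, and on coordinate vectors, where
  limits and lines are available.\<close>

lemma proj_dense_inI:
  assumes "X \<subseteq> proj_space n" "D \<subseteq> X"
    and "\<And>d f v. \<lbrakk>is_form n d f; \<And>w. w \<in> hvec n \<Longrightarrow> ppoint_of w \<in> D \<Longrightarrow> peval f w = 0;
            v \<in> hvec n; ppoint_of v \<in> X\<rbrakk> \<Longrightarrow> peval f v = 0"
  shows "proj_dense_in n D X"
  unfolding proj_dense_in_def
proof (intro conjI allI impI subsetI)
  fix Z P assume "proj_closed n Z \<and> D \<subseteq> Z" "P \<in> X"
  then obtain S where S: "\<And>f. f \<in> S \<Longrightarrow> \<exists>d. is_form n d f" "Z = zero_locus n S" "D \<subseteq> Z"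
    by (auto simp: proj_closed_def)
  obtain v where v: "v \<in> hvec n" "P = ppoint_of v"
    using \<open>P \<in> X\<close> assms(1) by (auto simp: proj_space_def)
  have "peval f v = 0" if "f \<in> S" for f
  proof -
    obtain d where d: "is_form n d f" using S(1) \<open>f \<in> S\<close> by blast
    show ?thesis
    proof (rule assms(3)[OF d])
      fix w assume "w \<in> hvec n" "ppoint_of w \<in> D"
      then show "peval f w = 0"
        using S that ppoint_of_mem_zero_locus[of w n S] by blast
    qed (use v \<open>P \<in> X\<close> in auto)
  qed
  then show "P \<in> Z" using S v ppoint_of_mem_zero_locus[of v n S] by simp
qed (use assms(2) in auto)

section \<open>Polynomial functions and density\<close>

text \<open>Polynomial functions with complex coefficients: \<open>qpoly\<close> is too small, since
  lines and segments are drawn between complex points. The inductive form gives restriction to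
  lines, continuity and the splitting by parity by induction.\<close>

inductive polyfun :: "((nat \<Rightarrow> complex) \<Rightarrow> complex) \<Rightarrow> bool" where
  const: "polyfun (\<lambda>_. c)"
| coord: "polyfun (\<lambda>v. v i)"
| add: "polyfun f \<Longrightarrow> polyfun g \<Longrightarrow> polyfun (\<lambda>v. f v + g v)"
| mult: "polyfun f \<Longrightarrow> polyfun g \<Longrightarrow> polyfun (\<lambda>v. f v * g v)"

lemma polyfun_sum: "(\<And>a. a \<in> A \<Longrightarrow> polyfun (f a)) \<Longrightarrow> polyfun (\<lambda>v. \<Sum>a\<in>A. f a v)"
  by (induction A rule: infinite_finite_induct) (auto intro: polyfun.intros)

lemma polyfun_prod: "(\<And>a. a \<in> A \<Longrightarrow> polyfun (f a)) \<Longrightarrow> polyfun (\<lambda>v. \<Prod>a\<in>A. f a v)"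
  by (induction A rule: infinite_finite_induct) (auto intro: polyfun.intros)

lemma polyfun_power: "polyfun f \<Longrightarrow> polyfun (\<lambda>v. f v ^ n)"
  by (induction n) (auto intro: polyfun.intros)

lemma polyfun_peval: "polyfun (peval p)"
  unfolding peval_def[abs_def]
  by (intro polyfun_sum polyfun_prod polyfun_power polyfun.intros)

lemma polyfun_on_line:
  assumes "polyfun h"
  shows "\<exists>q. \<forall>t. h (\<lambda>i. a i + t * b i) = poly q t"
  using assms
proof induction
  case (const c)
  then show ?case by (intro exI[of _ "[:c:]"]) simp
next
  case (coord i)
  then show ?case by (intro exI[of _ "[:a i, b i:]"]) (simp add: mult.commute)
next
  case (add f g)
  then obtain p q where "\<forall>t. f (\<lambda>i. a i + t * b i) = poly p t"
    "\<forall>t. g (\<lambda>i. a i + t * b i) = poly q t" by blast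
  then show ?case by (intro exI[of _ "p + q"]) simp
next
  case (mult f g)
  then obtain p q where "\<forall>t. f (\<lambda>i. a i + t * b i) = poly p t"
    "\<forall>t. g (\<lambda>i. a i + t * b i) = poly q t" by blast
  then show ?case by (intro exI[of _ "p * q"]) simp
qed

lemma polyfun_tendsto:
  assumes "polyfun h" "\<And>i. ((\<lambda>t. y t i) \<longlongrightarrow> v i) F"
  shows "((\<lambda>t. h (y t)) \<longlongrightarrow> h v) F"
  using assms(1) by induction (auto intro!: tendsto_intros assms(2))

text \<open>\<open>A\<close> and \<open>B\<close> are the even and odd parts in the variable
  \<open>j\<close>, read as functions of its square. In a product the two odd parts contribute the
  square of \<open>Y j\<close>, which after the substitution is coordinate \<open>j\<close>
  itself.\<close>

lemma polyfun_even_odd: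
  assumes "polyfun h"
  shows "\<exists>A B. polyfun A \<and> polyfun B \<and>
    (\<forall>Y. h Y = A (Y(j := (Y j)\<^sup>2)) + Y j * B (Y(j := (Y j)\<^sup>2)))"
  using assms
proof induction
  case (const c)
  then show ?case by (rule exI[of _ "\<lambda>_. c"], rule exI[of _ "\<lambda>_. 0"]) (auto intro: polyfun.intros)
next
  case (coord i)
  show ?case
  proof (cases "i = j")
    case True
    show ?thesis unfolding True
      by (rule exI[of _ "\<lambda>_. 0"], rule exI[of _ "\<lambda>_. 1"]) (auto intro: polyfun.intros)
  next
    case False
    show ?thesis
      by (rule exI[of _ "\<lambda>v. v i"], rule exI[of _ "\<lambda>_. 0"]) (use False in \<open>auto intro: polyfun.intros\<close>)
  qed
next
  case (add f g)
  then obtain A B C D where *: "polyfun A" "polyfun B" "polyfun C" "polyfun D"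
    "\<forall>Y. f Y = A (Y(j := (Y j)\<^sup>2)) + Y j * B (Y(j := (Y j)\<^sup>2))"
    "\<forall>Y. g Y = C (Y(j := (Y j)\<^sup>2)) + Y j * D (Y(j := (Y j)\<^sup>2))" by blast
  show ?case
    by (rule exI[of _ "\<lambda>v. A v + C v"], rule exI[of _ "\<lambda>v. B v + D v"],
        intro conjI allI polyfun.intros *(1-4)) (simp add: *(5,6) fun_upd_def algebra_simps)
next
  case (mult f g)
  then obtain A B C D where *: "polyfun A" "polyfun B" "polyfun C" "polyfun D"
    "\<forall>Y. f Y = A (Y(j := (Y j)\<^sup>2)) + Y j * B (Y(j := (Y j)\<^sup>2))"
    "\<forall>Y. g Y = C (Y(j := (Y j)\<^sup>2)) + Y j * D (Y(j := (Y j)\<^sup>2))" by blast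
  show ?case
    by (rule exI[of _ "\<lambda>v. A v * C v + v j * (B v * D v)"],
        rule exI[of _ "\<lambda>v. A v * D v + B v * C v"],
        intro conjI allI polyfun.intros *(1-4)) (simp add: *(5,6) fun_upd_def algebra_simps power2_eq_square)
qed

text \<open>The norm with respect to the square roots of the first \<open>n\<close> coordinates: the product of
  \<open>h\<close> over all choices of signs is a polynomial in the squares.\<close>

lemma polyfun_norm:
  assumes "polyfun h"
  shows "\<exists>N. polyfun N \<and> (\<forall>Z. N Z = 0 \<longleftrightarrow>
    (\<exists>Y. (\<forall>j<n. (Y j)\<^sup>2 = Z j) \<and> (\<forall>j\<ge>n. Y j = Z j) \<and> h Y = 0))"
proof (induction n)
  case 0
  show ?case
    by (rule exI[of _ h]) (simp add: assms flip: fun_eq_iff)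
next
  case (Suc n)
  then obtain N where N: "polyfun N" "\<And>Z. N Z = 0 \<longleftrightarrow>
    (\<exists>Y. (\<forall>j<n. (Y j)\<^sup>2 = Z j) \<and> (\<forall>j\<ge>n. Y j = Z j) \<and> h Y = 0)" by blast
  obtain A B where AB: "polyfun A" "polyfun B"
    "\<And>Y. N Y = A (Y(n := (Y n)\<^sup>2)) + Y n * B (Y(n := (Y n)\<^sup>2))"
    using polyfun_even_odd[OF N(1), of n] by blast
  \<comment> \<open>The product \<open>(A + r*B) * (A - r*B)\<close> over the two roots
    \<open>r\<close>, \<open>-r\<close> of \<open>Z n\<close>, written without
    \<open>r\<close>.\<close>
  let ?N = "\<lambda>Z. A Z * A Z + (-1) * (Z n * (B Z * B Z))"
  have "?N Z = 0 \<longleftrightarrow>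
    (\<exists>Y. (\<forall>j<Suc n. (Y j)\<^sup>2 = Z j) \<and> (\<forall>j\<ge>Suc n. Y j = Z j) \<and> h Y = 0)" for Z
  proof -
    define r where "r = csqrt (Z n)"
    have r: "r\<^sup>2 = Z n" by (simp add: r_def)
    have "N (Z(n := r)) = A Z + r * B Z" "N (Z(n := - r)) = A Z - r * B Z"
      using r by (simp_all add: AB(3))
    then have "?N Z = N (Z(n := r)) * N (Z(n := - r))"
      unfolding r[symmetric] by (simp only:) (simp add: algebra_simps power2_eq_square)
    also have "\<dots> = 0 \<longleftrightarrow> (\<exists>s. s\<^sup>2 = Z n \<and> N (Z(n := s)) = 0)"
      unfolding mult_eq_0_iff using r power2_eq_iff[of _ r] by auto
    also have "\<dots> \<longleftrightarrow>
      (\<exists>Y. (\<forall>j<Suc n. (Y j)\<^sup>2 = Z j) \<and> (\<forall>j\<ge>Suc n. Y j = Z j) \<and> h Y = 0)" (is "?l \<longleftrightarrow> ?r")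
    proof
      assume ?l
      then obtain s Y where "s\<^sup>2 = Z n" "\<forall>j<n. (Y j)\<^sup>2 = (Z(n := s)) j"
        "\<forall>j\<ge>n. Y j = (Z(n := s)) j" "h Y = 0" unfolding N(2) by blast
      then show ?r by (intro exI[of _ Y]) (auto simp: less_Suc_eq)
    next
      assume ?r
      then obtain Y where Y: "\<forall>j<Suc n. (Y j)\<^sup>2 = Z j" "\<forall>j\<ge>Suc n. Y j = Z j" "h Y = 0"
        by blast
      show ?l unfolding N(2)
        by (rule exI[of _ "Y n"], intro conjI exI[of _ Y])
          (use Y in \<open>auto simp: less_Suc_eq Suc_le_eq\<close>)
    qed
    finally show ?thesis .
  qed
  moreover have "polyfun ?N" by (intro polyfun.intros AB)
  ultimately show ?case by blast
qed

text \<open>Since \<open>(y - v) * (y + v) = w - v^2\<close>, choose the sign that makes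
  \<open>y - v\<close> the factor of smaller modulus. The estimate also covers \<open>v = 0\<close>,
  where no continuous branch of the root exists.\<close>

lemma square_root_near:
  fixes w v :: complex
  shows "\<exists>y. y\<^sup>2 = w \<and> (cmod (y - v))\<^sup>2 \<le> cmod (w - v\<^sup>2)"
proof -
  define r where "r = csqrt w"
  have r: "r\<^sup>2 = w" by (simp add: r_def)
  define y where "y = (if cmod (r - v) \<le> cmod (r + v) then r else - r)"
  have "cmod (- r - v) = cmod (r + v)" "cmod (- r + v) = cmod (r - v)"
    using norm_minus_cancel[of "r + v"] norm_minus_cancel[of "r - v"] by auto
  then have le: "cmod (y - v) \<le> cmod (y + v)"
    unfolding y_def by auto
  have y: "y\<^sup>2 = w" using r by (auto simp: y_def)
  have "(cmod (y - v))\<^sup>2 \<le> cmod (y - v) * cmod (y + v)"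
    using le by (simp add: power2_eq_square mult_left_mono)
  also have "\<dots> = cmod (w - v\<^sup>2)"
    by (simp add: y[symmetric] power2_eq_square algebra_simps flip: norm_mult)
  finally show ?thesis using y by blast
qed

text \<open>The norm of \<open>g\<close> along the segment from \<open>v\<^sup>2\<close> to \<open>Z\<close> is a polynomial in \<open>t\<close> that does not
  vanish at \<open>t = 1\<close>; hence \<open>g \<noteq> 0\<close> over all small \<open>t \<noteq> 0\<close>, and square roots over such \<open>t\<close> can be
  chosen to converge to \<open>v\<close>.\<close>

lemma vanish_by_square_path:
  assumes f: "polyfun f" and g: "polyfun g"
    and Z: "\<And>Y. (\<forall>j<n. (Y j)\<^sup>2 = Z j) \<Longrightarrow> (\<forall>j\<ge>n. Y j = 0) \<Longrightarrow> g Y \<noteq> 0"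
    and fin: "\<And>j. j \<ge> n \<Longrightarrow> v j = 0"
    and van: "\<And>t Y. (\<forall>j<n. (Y j)\<^sup>2 = (v j)\<^sup>2 + t * (Z j - (v j)\<^sup>2)) \<Longrightarrow>
           (\<forall>j\<ge>n. Y j = 0) \<Longrightarrow> g Y \<noteq> 0 \<Longrightarrow> f Y = 0"
  shows "f v = 0"
proof -
  obtain N where N: "polyfun N" "\<And>Z. N Z = 0 \<longleftrightarrow>
    (\<exists>Y. (\<forall>j<n. (Y j)\<^sup>2 = Z j) \<and> (\<forall>j\<ge>n. Y j = Z j) \<and> g Y = 0)"
    using polyfun_norm[OF g] by blast
  \<comment> \<open>Both \<open>a\<close> and \<open>b\<close> are 0 from \<open>n\<close> on, so
    the clause \<open>Y j = Z j\<close> of the norm reads \<open>Y j = 0\<close> there along the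
    whole line.\<close>
  define a where "a = (\<lambda>j. if j < n then (v j)\<^sup>2 else 0)"
  define b where "b = (\<lambda>j. if j < n then Z j - (v j)\<^sup>2 else 0)"
  obtain q where q: "\<And>t. N (\<lambda>i. a i + t * b i) = poly q t"
    using polyfun_on_line[OF N(1)] by blast
  have "poly q 1 \<noteq> 0"
    unfolding q[symmetric] N(2) using Z by (auto simp: a_def b_def)
  then have "q \<noteq> 0" by auto
  then have fin_roots: "finite {t. poly q t = 0}" by (rule poly_roots_finite)
  \<comment> \<open>The root is picked for each \<open>t\<close> separately; continuity in
    \<open>t\<close> is not claimed, only closeness to \<open>v j\<close> as \<open>t\<close> tends
    to 0.\<close>
  define y where "y = (\<lambda>t j. SOME y. y\<^sup>2 = a j + t * b j \<and> (cmod (y - v j))\<^sup>2 \<le> cmod (a j + t * b j - (v j)\<^sup>2))"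
  have y: "(y t j)\<^sup>2 = a j + t * b j" "(cmod (y t j - v j))\<^sup>2 \<le> cmod (a j + t * b j - (v j)\<^sup>2)" for t j
    using someI_ex[OF square_root_near[of "a j + t * b j" "v j"]] by (auto simp: y_def)
  have y0: "y t j = 0" if "j \<ge> n" for t j
    using y(1)[of t j] that by (simp add: a_def b_def)
  have lim: "((\<lambda>t. y t j) \<longlongrightarrow> v j) (at 0)" for j
  proof -
    have "((\<lambda>t. sqrt (cmod (a j + t * b j - (v j)\<^sup>2))) \<longlongrightarrow> sqrt (cmod (a j + 0 * b j - (v j)\<^sup>2))) (at 0)"
      by (intro tendsto_intros)
    moreover have "a j = (v j)\<^sup>2" using fin[of j] by (simp add: a_def)
    ultimately have S: "((\<lambda>t. sqrt (cmod (a j + t * b j - (v j)\<^sup>2))) \<longlongrightarrow> 0) (at 0)" by simp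
    have le: "cmod (y t j - v j) \<le> sqrt (cmod (a j + t * b j - (v j)\<^sup>2))" for t
      using y(2)[of t j] by (rule real_le_rsqrt)
    have "((\<lambda>t. cmod (y t j - v j)) \<longlongrightarrow> 0) (at 0)"
      by (rule tendsto_sandwich[OF _ _ tendsto_const S]) (rule always_eventually, simp add: le)+
    then have "((\<lambda>t. y t j - v j) \<longlongrightarrow> 0) (at 0)"
      by (rule tendsto_norm_zero_cancel)
    then show ?thesis by (rule LIM_zero_cancel)
  qed
  have "((\<lambda>t. f (y t)) \<longlongrightarrow> f v) (at 0)" by (rule polyfun_tendsto[OF f lim])
  moreover have "\<forall>\<^sub>F t in at 0. f (y t) = 0"
  proof -
    \<comment> \<open>The value 0 is taken out of the bad parameters because \<open>g\<close> may
      vanish over \<open>t = 0\<close>, for instance at \<open>v\<close> itself.\<close>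
    have "open (- ({t. poly q t = 0} - {0}))"
      using fin_roots by (intro open_Compl finite_imp_closed) simp
    then have "\<forall>\<^sub>F t in at 0. t \<notin> {t. poly q t = 0}"
      unfolding eventually_at_topological by blast
    then show ?thesis
    proof eventually_elim
      case (elim t)
      then have "N (\<lambda>i. a i + t * b i) \<noteq> 0" using q by simp
      moreover have "N (\<lambda>i. a i + t * b i) = 0" if "g (y t) = 0"
        unfolding N(2)
        by (rule exI[of _ "y t"]) (simp add: that y(1) y0 a_def b_def)
      ultimately have "g (y t) \<noteq> 0" by blast
      then show ?case
        by (intro van[of "y t" t]) (simp_all add: y(1) y0 a_def b_def)
    qed
  qed
  ultimately have "((\<lambda>_. 0) \<longlongrightarrow> f v) (at (0::complex))"
    by (subst (asm) tendsto_cong) auto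
  then show ?thesis by (simp add: tendsto_const_iff)
qed

text \<open>On the line \<open>f\<close> and \<open>g\<close> become polynomials in \<open>t\<close>
  with product zero; the one from \<open>g\<close> is nonzero at \<open>t = 1\<close>, so the one
  from \<open>f\<close> is zero, in particular at \<open>t = 0\<close>.\<close>

lemma vanish_by_line:
  assumes f: "polyfun f" and g: "polyfun g" and w: "g w \<noteq> 0"
    and van: "\<And>t. g (\<lambda>i. v i + t * (w i - v i)) \<noteq> 0 \<Longrightarrow> f (\<lambda>i. v i + t * (w i - v i)) = 0"
  shows "f v = 0"
proof -
  obtain p where p: "\<And>t. f (\<lambda>i. v i + t * (w i - v i)) = poly p t"
    using polyfun_on_line[OF f, of v "\<lambda>i. w i - v i"] by blast
  obtain q where q: "\<And>t. g (\<lambda>i. v i + t * (w i - v i)) = poly q t"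
    using polyfun_on_line[OF g, of v "\<lambda>i. w i - v i"] by blast
  have "poly q 1 \<noteq> 0" using w q[of 1] by simp
  moreover have "poly (p * q) = poly 0"
    using van unfolding p q by (auto simp: fun_eq_iff)
  then have "p * q = 0" by (simp only: poly_eq_poly_eq_iff)
  ultimately have "p = 0" by auto
  then show ?thesis using p[of 0] by simp
qed

section \<open>Interpolation\<close>

text \<open>Generic in the field because both instances occur: the rational one supplies
  coefficients of forms, the complex one their evaluations.\<close>

definition lag :: "(nat \<Rightarrow> 'a::field) \<Rightarrow> nat \<Rightarrow> nat \<Rightarrow> 'a \<Rightarrow> 'a" where
  "lag a n j y = (\<Prod>i\<in>{..n}-{j}. (y - a i) / (a j - a i))"

definition interp :: "(nat \<Rightarrow> 'a::field) \<Rightarrow> nat \<Rightarrow> (nat \<Rightarrow> 'a) \<Rightarrow> 'a poly" where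
  "interp a n u = (\<Sum>j\<le>n. smult (u j) (\<Prod>i\<in>{..n}-{j}. smult (1 / (a j - a i)) [:- a i, 1:]))"

lemma poly_interp: "poly (interp a n u) y = (\<Sum>j\<le>n. u j * lag a n j y)"
  by (simp add: interp_def lag_def poly_sum poly_prod diff_divide_distrib)

lemma degree_interp: "degree (interp a n u) \<le> n"
  unfolding interp_def
proof (intro degree_sum_le order.trans[OF degree_smult_le])
  fix j assume "j \<in> {..n}"
  have "degree (\<Prod>i\<in>{..n}-{j}. smult (1 / (a j - a i)) [:- a i, 1:])
      \<le> (\<Sum>i\<in>{..n}-{j}. degree (smult (1 / (a j - a i)) [:- a i, 1:]))"
    by (rule degree_prod_sum_le[unfolded comp_def]) simp
  also have "\<dots> \<le> (\<Sum>i\<in>{..n}-{j}. 1)"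
    by (intro sum_mono order.trans[OF degree_smult_le]) simp
  also have "\<dots> = n" using \<open>j \<in> {..n}\<close> by simp
  finally show "degree (\<Prod>i\<in>{..n}-{j}. smult (1 / (a j - a i)) [:- a i, 1:]) \<le> n" .
qed simp

lemma lag_node:
  assumes "inj_on a {..n}" "j \<le> n" "l \<le> n"
  shows "lag a n j (a l) = (if j = l then 1 else 0)"
proof (cases "j = l")
  case True
  have "a j - a i \<noteq> 0" if "i \<in> {..n} - {j}" for i
    using assms that by (auto dest: inj_onD)
  then show ?thesis using True by (simp add: lag_def)
next
  case False
  then show ?thesis using assms by (auto simp: lag_def intro!: bexI[of _ l])
qed

lemma poly_interp_node:
  assumes "inj_on a {..n}" "l \<le> n"
  shows "poly (interp a n u) (a l) = u l"
proof -
  have "(\<Sum>j\<le>n. u j * lag a n j (a l)) = (\<Sum>j\<le>n. if j = l then u j else 0)"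
    by (rule sum.cong) (use assms in \<open>auto simp: lag_node\<close>)
  then show ?thesis using assms by (simp add: poly_interp)
qed

lemma poly_eq_of_card_nodes:
  fixes p q :: "'a::field poly"
  assumes "inj_on a A" "finite A" "degree p < card A" "degree q < card A"
    and "\<And>j. j \<in> A \<Longrightarrow> poly p (a j) = poly q (a j)"
  shows "p = q"
proof (rule poly_eqI_degree[where A = "a ` A"])
  show "card (a ` A) > degree p" "card (a ` A) > degree q"
    using assms by (auto simp: card_image)
qed (use assms in auto)

lemma interp_eq:
  assumes "inj_on a {..n}" "degree p \<le> n"
  shows "interp a n (\<lambda>j. poly p (a j)) = p"
  by (rule poly_eq_of_card_nodes[OF assms(1)])
    (use assms degree_interp[of a n] in \<open>auto simp: poly_interp_node less_Suc_eq_le\<close>)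

lemma poly_lagrange:
  assumes "inj_on a {..n}" "degree p \<le> n"
  shows "poly p y = (\<Sum>j\<le>n. poly p (a j) * lag a n j y)"
  using poly_interp[of a n "\<lambda>j. poly p (a j)" y] by (simp add: interp_eq[OF assms])

lemma poly_eq_sum_atMost:
  fixes p :: "'a::comm_semiring_1 poly"
  assumes "degree p \<le> n"
  shows "poly p y = (\<Sum>i\<le>n. coeff p i * y ^ i)"
  unfolding poly_altdef
  by (rule sum.mono_neutral_left) (use assms in \<open>auto simp: coeff_eq_0\<close>)

definition poly_of_coeffs :: "(nat \<Rightarrow> 'a::comm_monoid_add) \<Rightarrow> nat \<Rightarrow> 'a poly" where
  "poly_of_coeffs c n = (\<Sum>i\<le>n. monom (c i) i)"

lemma coeff_poly_of_coeffs: "coeff (poly_of_coeffs c n) i = (if i \<le> n then c i else 0)"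
  by (simp add: poly_of_coeffs_def coeff_sum)

lemma degree_poly_of_coeffs: "degree (poly_of_coeffs c n) \<le> n"
  by (rule degree_le) (simp add: coeff_poly_of_coeffs)

lemma poly_poly_of_coeffs:
  fixes y :: "'a::comm_semiring_1"
  shows "poly (poly_of_coeffs c n) y = (\<Sum>i\<le>n. c i * y ^ i)"
  by (simp add: poly_of_coeffs_def poly_sum poly_monom)

lemma of_real_of_rat: "complex_of_real (of_rat q) = of_rat q"
  by (cases q) (simp add: of_rat_rat)

lemma smult_mat_mult_vec:
  assumes "A \<in> carrier_mat nr nc" "v \<in> carrier_vec nc"
  shows "(c \<cdot>\<^sub>m A) *\<^sub>v v = c \<cdot>\<^sub>v (A *\<^sub>v v)"
  by (rule eq_vecI) (use assms in \<open>auto simp: scalar_prod_def sum_distrib_left mult.assoc\<close>)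

text \<open>Replaces sorting: the nodes come in no particular order, and cutting off lowest subsets
  yields the blocks used in \<open>ex_sign_split\<close>.\<close>

lemma ex_lowest_subset:
  fixes f :: "'b \<Rightarrow> 'c::linorder"
  assumes "finite S" "m \<le> card S"
  shows "\<exists>I\<subseteq>S. card I = m \<and> (\<forall>i\<in>I. \<forall>j\<in>S-I. f i \<le> f j)"
  using assms(2)
proof (induction m)
  case 0
  then show ?case by (intro exI[of _ "{}"]) auto
next
  case (Suc m)
  then obtain I where I: "I \<subseteq> S" "card I = m" "\<forall>i\<in>I. \<forall>j\<in>S-I. f i \<le> f j" by auto
  have "S - I \<noteq> {}" using I Suc.prems assms(1) by (metis Diff_eq_empty_iff card_mono finite_subset not_less_eq_eq)
  then have fin: "finite (f ` (S - I))" "f ` (S - I) \<noteq> {}" using assms(1) by auto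
  then have "Min (f ` (S - I)) \<in> f ` (S - I)" by (rule Min_in)
  then obtain a where a: "a \<in> S - I" "Min (f ` (S - I)) = f a" by blast
  have "f a \<le> f j" if "j \<in> S - I" for j
    using Min_le[OF fin(1), of "f j"] a(2) that by auto
  note a = a(1) this
  have "card (insert a I) = Suc m"
    using a I assms(1) finite_subset by (subst card_insert_disjoint) auto
  then show ?case using a I by (intro exI[of _ "insert a I"]) auto
qed

section \<open>The intersection of quadrics\<close>

locale nodes =
  fixes k :: nat and x :: "nat \<Rightarrow> rat"
  assumes inj_x: "inj_on x {..3*k+1}"
begin

definition X :: "nat \<Rightarrow> complex" where
  "X j = of_rat (x j)"

lemma inj_X: "inj_on X {..3*k+1}"
  using inj_x by (auto simp: X_def inj_on_def)

lemma of_rat_lag: "of_rat (lag x n j (x l)) = lag X n j (X l)"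
  by (simp add: lag_def X_def of_rat_prod of_rat_divide of_rat_diff)

text \<open>The forms \<open>chk i\<close> for \<open>i \<le> k\<close> are the parity checks of the space of all
  \<open>(p (X 0), \<dots>, p (X (3k+1)))\<close> with \<open>degree p \<le> 2k\<close>.\<close>

definition chk_coeff :: "nat \<Rightarrow> nat \<Rightarrow> rat" where
  "chk_coeff i j = (if j \<le> 2*k then - lag x (2*k) j (x (2*k+1+i))
                    else if j = 2*k+1+i then 1 else 0)"

definition chk :: "nat \<Rightarrow> (nat \<Rightarrow> complex) \<Rightarrow> complex" where
  "chk i u = (\<Sum>j\<le>3*k+1. of_rat (chk_coeff i j) * u j)"

lemma chk_cong: "(\<And>j. j \<le> 3*k+1 \<Longrightarrow> u j = w j) \<Longrightarrow> chk i u = chk i w"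
  unfolding chk_def by (rule sum.cong) auto

lemma chk_add: "chk i (\<lambda>j. u j + w j) = chk i u + chk i w"
  by (simp add: chk_def distrib_left sum.distrib)

lemma chk_scale: "chk i (\<lambda>j. c * u j) = c * chk i u"
  unfolding chk_def sum_distrib_left by (rule sum.cong) (simp_all add: mult_ac)

lemma chk_sum: "chk i (\<lambda>j. \<Sum>a\<in>A. u a j) = (\<Sum>a\<in>A. chk i (u a))"
  unfolding chk_def sum_distrib_left by (rule sum.swap)

lemma chk_eq:
  assumes "i \<le> k"
  shows "chk i u = u (2*k+1+i) - (\<Sum>j\<le>2*k. u j * lag X (2*k) j (X (2*k+1+i)))"
proof -
  have "{..3*k+1} = {..2*k} \<union> {2*k+1..3*k+1}" by auto
  then have "chk i u = (\<Sum>j\<le>2*k. of_rat (chk_coeff i j) * u j)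
      + (\<Sum>j\<in>{2*k+1..3*k+1}. of_rat (chk_coeff i j) * u j)"
    unfolding chk_def by (simp only:) (rule sum.union_disjoint, auto)
  also have "(\<Sum>j\<in>{2*k+1..3*k+1}. of_rat (chk_coeff i j) * u j)
      = (\<Sum>j\<in>{2*k+1..3*k+1}. if j = 2*k+1+i then u j else 0)"
    by (rule sum.cong) (auto simp: chk_coeff_def)
  also have "\<dots> = u (2*k+1+i)" using assms by simp
  also have "(\<Sum>j\<le>2*k. of_rat (chk_coeff i j) * u j)
      = - (\<Sum>j\<le>2*k. u j * lag X (2*k) j (X (2*k+1+i)))"
    unfolding sum_negf[symmetric]
    by (rule sum.cong) (simp_all only: atMost_iff chk_coeff_def if_True of_rat_minus of_rat_lag, simp)
  finally show ?thesis by simp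
qed

text \<open>By \<open>chk_eq\<close> a check is the error, at one further node, of extrapolating
  from the nodes 0 to 2k. If all errors vanish, the interpolant through these 2k+1 nodes fits
  everywhere; conversely Lagrange's formula is exact in degree at most 2k.\<close>

lemma chk_zero_iff:
  "(\<forall>i\<le>k. chk i u = 0) \<longleftrightarrow> (\<exists>p. degree p \<le> 2*k \<and> (\<forall>j\<le>3*k+1. u j = poly p (X j)))"
proof
  assume *: "\<forall>i\<le>k. chk i u = 0"
  have inj: "inj_on X {..2*k}" by (rule inj_on_subset[OF inj_X]) auto
  have "u j = poly (interp X (2*k) u) (X j)" if j: "j \<le> 3*k+1" for j
  proof (cases "j \<le> 2*k")
    case True
    then show ?thesis using poly_interp_node[OF inj True] by simp
  next
    case False
    then have "chk (j - (2*k+1)) u = 0" "j - (2*k+1) \<le> k" "2*k+1+(j-(2*k+1)) = j"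
      using * j by auto
    then show ?thesis using chk_eq[of "j - (2*k+1)" u] by (simp add: poly_interp)
  qed
  then show "\<exists>p. degree p \<le> 2*k \<and> (\<forall>j\<le>3*k+1. u j = poly p (X j))"
    using degree_interp by blast
next
  assume "\<exists>p. degree p \<le> 2*k \<and> (\<forall>j\<le>3*k+1. u j = poly p (X j))"
  then obtain p where p: "degree p \<le> 2*k" "\<And>j. j \<le> 3*k+1 \<Longrightarrow> u j = poly p (X j)" by blast
  have inj: "inj_on X {..2*k}" by (rule inj_on_subset[OF inj_X]) auto
  have "chk i u = 0" if i: "i \<le> k" for i
  proof -
    have "chk i u = poly p (X (2*k+1+i)) - (\<Sum>j\<le>2*k. poly p (X j) * lag X (2*k) j (X (2*k+1+i)))"
      unfolding chk_eq[OF i] using p(2) i by simp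
    then show ?thesis by (simp only: poly_lagrange[OF inj p(1), symmetric] diff_self)
  qed
  then show "\<forall>i\<le>k. chk i u = 0" by blast
qed

lemma chk_poly: "degree p \<le> 2*k \<Longrightarrow> i \<le> k \<Longrightarrow> chk i (\<lambda>j. poly p (X j)) = 0"
  using chk_zero_iff by blast

lemma is_form_quadric:
  assumes "i \<le> 3*k+1"
  shows "is_form (3*k+1) 2 (quadric k x i)"
proof -
  have "is_form (3*k+1) (\<Sum>r<2*k+2. if r \<le> 2*k then 0 else 2) (quadric k x i)"
    unfolding quadric_def
  proof (rule is_form_det[OF mat_carrier])
    fix r c assume "r < 2*k+2" "c < 2*k+2"
    moreover have "is_form (3*k+1) (1 + 1) (pvar j * pvar j)" if "j \<le> 3*k+1" for j
      using that by (intro is_form_mult is_form_pvar) auto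
    ultimately show "is_form (3*k+1) (if r \<le> 2*k then 0 else 2) (mat (2*k+2) (2*k+2) (\<lambda>(r, c).
       let j = (if c \<le> 2*k then c else i)
       in if r \<le> 2*k then pconst (x j ^ r) else pvar j ^ 2) $$ (r, c))"
      using assms by (auto simp: Let_def is_form_pconst power2_eq_square numeral_2_eq_2)
  qed
  moreover have "(\<Sum>r<2*k+2. if r \<le> 2*k then 0 else 2) = (2::nat)"
  proof -
    have "(\<Sum>r<2*k+2. if r \<le> 2*k then 0 else 2) = (\<Sum>r<2*k+2. if r = 2*k+1 then 2 else (0::nat))"
      by (rule sum.cong) auto
    then show ?thesis by simp
  qed
  ultimately show ?thesis by (simp only:)
qed

text \<open>A singular matrix means a linear relation between its rows, that is, a polynomial of
  degree at most 2k plus a multiple of the row of squares that vanishes at 2k+2 distinct nodes. The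
  multiple is nonzero, as the polynomial alone would have too many zeros; dividing by it
  interpolates the squares.\<close>

lemma peval_quadric_eq_0_iff:
  assumes i: "i \<le> k"
  shows "peval (quadric k x (2*k+1+i)) v = 0 \<longleftrightarrow> chk i (\<lambda>j. (v j)\<^sup>2) = 0"
proof -
  define s where "s = (\<lambda>c. if c \<le> 2*k then c else 2*k+1+i)"
  \<comment> \<open>Transposed, so that a kernel vector lists the coefficients of a relation between
    the rows of the original matrix.\<close>
  define B where "B = mat (2*k+2) (2*k+2) (\<lambda>(c, r). if r \<le> 2*k then X (s c) ^ r else (v (s c))\<^sup>2)"
  have B: "B \<in> carrier_mat (2*k+2) (2*k+2)" by (simp add: B_def)
  have inj: "inj_on X {..2*k}" by (rule inj_on_subset[OF inj_X]) auto
  have inj_s: "inj_on (\<lambda>c. X (s c)) {..2*k+1}"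
    by (rule inj_onI) (use i inj_onD[OF inj_X] in \<open>force simp: s_def split: if_splits\<close>)
  have "peval (quadric k x (2*k+1+i)) v = det (transpose_mat B)"
    unfolding quadric_def peval_hom.hom_det[symmetric]
    by (rule arg_cong[of _ _ det], rule eq_matI)
      (auto simp: s_def B_def Let_def X_def of_rat_power peval_hom.hom_power)
  also have "\<dots> = det B" by (rule det_transpose[OF B])
  also have "det B = 0 \<longleftrightarrow> (\<exists>w. w \<in> carrier_vec (2*k+2) \<and> w \<noteq> 0\<^sub>v (2*k+2) \<and> B *\<^sub>v w = 0\<^sub>v (2*k+2))"
    by (rule det_0_iff_vec_prod_zero_field[OF B])
  also have "\<dots> \<longleftrightarrow> chk i (\<lambda>j. (v j)\<^sup>2) = 0"
  proof -
    have prod: "(B *\<^sub>v w) $ c = poly (poly_of_coeffs (\<lambda>r. w $ r) (2*k)) (X (s c)) + w $ (2*k+1) * (v (s c))\<^sup>2"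
      if "w \<in> carrier_vec (2*k+2)" "c \<le> 2*k+1" for w c
    proof -
      have "(B *\<^sub>v w) $ c = (\<Sum>r<2*k+2. B $$ (c, r) * w $ r)"
        using that B by (auto simp: scalar_prod_def lessThan_atLeast0 intro!: sum.cong)
      also have "\<dots> = (\<Sum>r<2*k+2. w $ r * (if r \<le> 2*k then X (s c) ^ r else (v (s c))\<^sup>2))"
        by (rule sum.cong) (use that in \<open>simp_all add: B_def\<close>)
      also have "{..<2*k+2} = insert (2*k+1) {..2*k}" by auto
      also have "(\<Sum>r\<in>insert (2*k+1) {..2*k}. w $ r * (if r \<le> 2*k then X (s c) ^ r else (v (s c))\<^sup>2))
          = w $ (2*k+1) * (v (s c))\<^sup>2 + (\<Sum>r\<le>2*k. w $ r * X (s c) ^ r)"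
        by (subst sum.insert) (auto intro!: sum.cong)
      finally show ?thesis by (simp add: poly_poly_of_coeffs add_ac)
    qed
    show ?thesis
    proof
      assume "\<exists>w. w \<in> carrier_vec (2*k+2) \<and> w \<noteq> 0\<^sub>v (2*k+2) \<and> B *\<^sub>v w = 0\<^sub>v (2*k+2)"
      then obtain w where w: "w \<in> carrier_vec (2*k+2)" "w \<noteq> 0\<^sub>v (2*k+2)" "B *\<^sub>v w = 0\<^sub>v (2*k+2)"
        by blast
      let ?P = "poly_of_coeffs (\<lambda>r. w $ r) (2*k)"
      have z: "poly ?P (X (s c)) + w $ (2*k+1) * (v (s c))\<^sup>2 = 0" if "c \<le> 2*k+1" for c
        using prod[OF w(1) that] w(3) that by simp
      have "w $ (2*k+1) \<noteq> 0"
      proof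
        assume 0: "w $ (2*k+1) = 0"
        have "?P = 0"
          by (rule poly_eq_of_card_nodes[OF inj_s])
            (use z 0 degree_poly_of_coeffs[of "\<lambda>r. w $ r" "2*k"] in \<open>auto simp: less_Suc_eq_le\<close>)
        then have "w $ r = 0" if "r \<le> 2*k" for r
          using coeff_poly_of_coeffs[of "\<lambda>r. w $ r" "2*k" r] that by simp
        then have "w $ r = 0" if "r < 2*k+2" for r
          using 0 that by (cases "r = 2*k+1") auto
        then show False using w(1,2) by auto
      qed
      define p where "p = smult (- 1 / w $ (2*k+1)) ?P"
      have p: "(v (s c))\<^sup>2 = poly p (X (s c))" if "c \<le> 2*k+1" for c
        using z[OF that] \<open>w $ (2*k+1) \<noteq> 0\<close> by (simp add: p_def field_simps eq_neg_iff_add_eq_0)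
      have "degree p \<le> 2*k"
        unfolding p_def by (rule order.trans[OF degree_smult_le degree_poly_of_coeffs])
      have "chk i (\<lambda>j. (v j)\<^sup>2) = poly p (X (2*k+1+i)) - (\<Sum>j\<le>2*k. poly p (X j) * lag X (2*k) j (X (2*k+1+i)))"
      proof -
        have "(v (2*k+1+i))\<^sup>2 = poly p (X (2*k+1+i))" using p[of "2*k+1"] by (simp add: s_def)
        moreover have "(v j)\<^sup>2 = poly p (X j)" if "j \<le> 2*k" for j
          using p[of j] that by (simp add: s_def)
        ultimately show ?thesis unfolding chk_eq[OF i] by simp
      qed
      then show "chk i (\<lambda>j. (v j)\<^sup>2) = 0"
        by (simp only: poly_lagrange[OF inj \<open>degree p \<le> 2*k\<close>, symmetric] diff_self)
    next
      assume 0: "chk i (\<lambda>j. (v j)\<^sup>2) = 0"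
      let ?p = "interp X (2*k) (\<lambda>j. (v j)\<^sup>2)"
      define w where "w = vec (2*k+2) (\<lambda>r. if r \<le> 2*k then coeff ?p r else - 1)"
      have w: "w \<in> carrier_vec (2*k+2)" "w $ (2*k+1) = -1" by (simp_all add: w_def)
      have "poly_of_coeffs (\<lambda>r. w $ r) (2*k) = ?p"
        by (rule poly_eqI) (use degree_interp[of X "2*k" "\<lambda>j. (v j)\<^sup>2"] in
            \<open>auto simp: coeff_poly_of_coeffs w_def coeff_eq_0\<close>)
      moreover have "poly ?p (X (s c)) = (v (s c))\<^sup>2" if "c \<le> 2*k+1" for c
      proof (cases "c \<le> 2*k")
        case True
        then show ?thesis using poly_interp_node[OF inj True] by (simp add: s_def)
      next
        case False
        then show ?thesis using 0 unfolding chk_eq[OF i] by (simp add: s_def poly_interp)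
      qed
      ultimately have "(B *\<^sub>v w) $ c = 0" if "c \<le> 2*k+1" for c
        using prod[OF w(1) that] that w(2) by simp
      then have "B *\<^sub>v w = 0\<^sub>v (2*k+2)"
        by (intro eq_vecI) (use B in auto)
      moreover have "w \<noteq> 0\<^sub>v (2*k+2)"
      proof
        assume "w = 0\<^sub>v (2*k+2)"
        then have "w $ (2*k+1) = 0" by simp
        then show False using w(2) by simp
      qed
      ultimately show "\<exists>w. w \<in> carrier_vec (2*k+2) \<and> w \<noteq> 0\<^sub>v (2*k+2) \<and> B *\<^sub>v w = 0\<^sub>v (2*k+2)"
        using w(1) by blast
    qed
  qed
  finally show ?thesis .
qed

lemma mem_quadric_intersection:
  assumes "v \<in> hvec (3*k+1)"
  shows "ppoint_of v \<in> quadric_intersection k x \<longleftrightarrow> (\<forall>i\<le>k. chk i (\<lambda>j. (v j)\<^sup>2) = 0)"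
proof -
  have range: "j \<in> {2*k+1..3*k+1} \<longleftrightarrow> (\<exists>i\<le>k. j = 2*k+1+i)" for j
    by (auto intro!: exI[of _ "j - (2*k+1)"])
  have "ppoint_of v \<in> quadric_intersection k x \<longleftrightarrow>
      (\<forall>f\<in>quadric k x ` {2*k+1..3*k+1}. peval f v = 0)"
    unfolding quadric_intersection_def
    by (rule ppoint_of_mem_zero_locus[OF assms]) (use is_form_quadric in \<open>fastforce simp: image_iff\<close>)
  also have "{2*k+1..3*k+1} = (\<lambda>i. 2*k+1+i) ` {..k}" using range by auto
  finally show ?thesis using peval_quadric_eq_0_iff by auto
qed

lemma proj_closed_quadric_intersection: "proj_closed (3*k+1) (quadric_intersection k x)"
  unfolding proj_closed_def quadric_intersection_def
  by (rule exI[of _ "quadric k x ` {2*k+1..3*k+1}"]) (use is_form_quadric in \<open>fastforce simp: image_iff\<close>)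

section \<open>The determinant of the linear system and its zeros\<close>

text \<open>Up to a factor 2, the derivatives at \<open>Y\<close> of the k+1 equations
  \<open>chk i\<close> of the squares in the directions of the basis \<open>X j ^ b\<close> of
  L.\<close>

definition chk_mat :: "(nat \<Rightarrow> complex) \<Rightarrow> complex mat" where
  "chk_mat Y = mat (k+1) (k+1) (\<lambda>(i, b). chk i (\<lambda>j. Y j * X j ^ b))"

lemma chk_mat_carrier [simp]: "chk_mat Y \<in> carrier_mat (k+1) (k+1)"
  by (simp add: chk_mat_def)

definition coeff_vec :: "complex poly \<Rightarrow> complex vec" where
  "coeff_vec q = vec (k+1) (coeff q)"

lemma coeff_vec_carrier [simp]: "coeff_vec q \<in> carrier_vec (k+1)"
  by (simp add: coeff_vec_def)

lemma chk_mat_mult_coeff_vec: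
  assumes "degree q \<le> k"
  shows "chk_mat Y *\<^sub>v coeff_vec q = vec (k+1) (\<lambda>i. chk i (\<lambda>j. Y j * poly q (X j)))"
proof (rule eq_vecI)
  fix i assume "i < dim_vec (vec (k+1) (\<lambda>i. chk i (\<lambda>j. Y j * poly q (X j))))"
  then have i: "i < k+1" by simp
  have "(chk_mat Y *\<^sub>v coeff_vec q) $ i = (\<Sum>b<k+1. chk i (\<lambda>j. Y j * X j ^ b) * coeff q b)"
    using i by (auto simp: scalar_prod_def lessThan_atLeast0 chk_mat_def coeff_vec_def intro!: sum.cong)
  also have "\<dots> = (\<Sum>b\<le>k. chk i (\<lambda>j. coeff q b * (Y j * X j ^ b)))"
    by (rule sum.cong) (auto simp: chk_scale mult.commute)
  also have "\<dots> = chk i (\<lambda>j. \<Sum>b\<le>k. coeff q b * (Y j * X j ^ b))"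
    by (simp only: chk_sum)
  also have "(\<lambda>j. \<Sum>b\<le>k. coeff q b * (Y j * X j ^ b)) = (\<lambda>j. Y j * poly q (X j))"
    by (simp only: poly_eq_sum_atMost[OF assms] sum_distrib_left mult_ac)
  finally show "(chk_mat Y *\<^sub>v coeff_vec q) $ i = vec (k+1) (\<lambda>i. chk i (\<lambda>j. Y j * poly q (X j))) $ i"
    using i by simp
qed (simp add: chk_mat_def)

lemma ex_coeff_vec:
  assumes "w \<in> carrier_vec (k+1)"
  shows "\<exists>q. degree q \<le> k \<and> w = coeff_vec q"
  by (rule exI[of _ "poly_of_coeffs (\<lambda>b. w $ b) k"])
    (use assms in \<open>auto simp: degree_poly_of_coeffs coeff_vec_def coeff_poly_of_coeffs less_Suc_eq_le\<close>)

lemma det_chk_mat_eq_0_iff: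
  "det (chk_mat Y) = 0 \<longleftrightarrow>
    (\<exists>q. q \<noteq> 0 \<and> degree q \<le> k \<and> (\<forall>i\<le>k. chk i (\<lambda>j. Y j * poly q (X j)) = 0))"
proof -
  have "det (chk_mat Y) = 0 \<longleftrightarrow>
    (\<exists>w. w \<in> carrier_vec (k+1) \<and> w \<noteq> 0\<^sub>v (k+1) \<and> chk_mat Y *\<^sub>v w = 0\<^sub>v (k+1))"
    by (rule det_0_iff_vec_prod_zero_field) (rule chk_mat_carrier)
  also have "\<dots> \<longleftrightarrow> (\<exists>q. degree q \<le> k \<and> coeff_vec q \<noteq> 0\<^sub>v (k+1) \<and> chk_mat Y *\<^sub>v coeff_vec q = 0\<^sub>v (k+1))"
    using ex_coeff_vec coeff_vec_carrier by blast
  also have "\<dots> \<longleftrightarrow> (\<exists>q. q \<noteq> 0 \<and> degree q \<le> k \<and> (\<forall>i\<le>k. chk i (\<lambda>j. Y j * poly q (X j)) = 0))"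
  proof -
    have "coeff_vec q \<noteq> 0\<^sub>v (k+1) \<longleftrightarrow> q \<noteq> 0" if "degree q \<le> k" for q
    proof -
      have "coeff_vec q = 0\<^sub>v (k+1) \<longleftrightarrow> (\<forall>b\<le>k. coeff q b = 0)"
        by (auto simp: coeff_vec_def vec_eq_iff less_Suc_eq_le)
      also have "\<dots> \<longleftrightarrow> q = 0"
        using that by (auto simp: poly_eq_iff)
      finally show ?thesis by simp
    qed
    moreover have "chk_mat Y *\<^sub>v coeff_vec q = 0\<^sub>v (k+1) \<longleftrightarrow>
        (\<forall>i\<le>k. chk i (\<lambda>j. Y j * poly q (X j)) = 0)" if "degree q \<le> k" for q
      unfolding chk_mat_mult_coeff_vec[OF that] by (auto simp: vec_eq_iff less_Suc_eq_le)
    ultimately show ?thesis by blast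
  qed
  finally show ?thesis .
qed

text \<open>Times a power at most k, \<open>q\<close> still has degree at most 2k and is killed by
  the checks; so the matrix depends only on \<open>Y\<close> modulo L. The case \<open>q = 0\<close>
  serves as a congruence rule.\<close>

lemma chk_mat_shift:
  assumes "degree q \<le> k" and "\<And>j. j \<le> 3*k+1 \<Longrightarrow> Y' j = Y j + poly q (X j)"
  shows "chk_mat Y' = chk_mat Y"
proof (rule eq_matI)
  fix i b assume "i < dim_row (chk_mat Y)" "b < dim_col (chk_mat Y)"
  then have ib: "i \<le> k" "b \<le> k" by (simp_all add: chk_mat_def)
  have "chk i (\<lambda>j. Y' j * X j ^ b) = chk i (\<lambda>j. Y j * X j ^ b + poly (q * monom 1 b) (X j))"
    by (rule chk_cong) (simp add: assms(2) distrib_right poly_monom)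
  also have "\<dots> = chk i (\<lambda>j. Y j * X j ^ b)"
  proof -
    have "degree (q * monom 1 b) \<le> 2*k"
      using degree_mult_le[of q "monom 1 b"] degree_monom_le[of "1::complex" b] assms(1) ib by linarith
    then show ?thesis by (simp only: chk_add chk_poly[OF _ ib(1)] add_0_right)
  qed
  finally show "chk_mat Y' $$ (i, b) = chk_mat Y $$ (i, b)"
    using ib by (simp add: chk_mat_def)
qed (simp_all add: chk_mat_def)

lemma det_chk_mat_nonzero_imp:
  assumes "det (chk_mat Y) \<noteq> 0"
  shows "\<exists>j\<le>3*k+1. Y j \<noteq> 0"
proof (rule ccontr)
  assume "\<not> (\<exists>j\<le>3*k+1. Y j \<noteq> 0)"
  then have "chk i (\<lambda>j. Y j * poly 1 (X j)) = 0" for i by (simp add: chk_def)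
  then show False using assms unfolding det_chk_mat_eq_0_iff
    by (metis degree_1 le0 zero_neq_one)
qed

text \<open>The nodes are real, so the real parts of the values belong to the polynomial of the real
  parts of the coefficients, which has degree at most k and k+1 zeros.\<close>

lemma real_part_poly:
  fixes h :: "complex poly"
  assumes "degree h \<le> k" "J \<subseteq> {..3*k+1}" "card J = k+1"
    and "\<And>j. j \<in> J \<Longrightarrow> Re (poly h (X j)) = 0"
  shows "Re (poly h (X l)) = 0"
proof -
  define r where "r = poly_of_coeffs (\<lambda>b. Re (coeff h b)) k"
  have r: "poly r (of_rat (x j)) = Re (poly h (X j))" for j
  proof -
    have "X j ^ b = of_real (of_rat (x j) ^ b)" for b
      by (simp add: X_def of_real_of_rat)
    then show ?thesis
      unfolding r_def poly_poly_of_coeffs poly_eq_sum_atMost[OF assms(1)] by simp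
  qed
  have "r = 0"
  proof (rule poly_eq_of_card_nodes[where a = "\<lambda>j. of_rat (x j)" and A = J])
    show "inj_on (\<lambda>j. of_rat (x j) :: real) J"
      using inj_on_subset[OF inj_x assms(2)] by (auto simp: inj_on_def)
    show "degree r < card J" using degree_poly_of_coeffs[of _ k] assms(3) by (simp add: r_def less_Suc_eq_le)
  qed (use assms r finite_subset[OF assms(2)] in auto)
  then show ?thesis using r[of l] by simp
qed

text \<open>In increasing order the nodes are \<open>j0\<close>, then 2k-1 nodes of
  \<open>I\<close>, then the k+1 nodes of \<open>J\<close>, then one last node of \<open>I\<close>.
  At \<open>j0\<close> all 2k factors are negative; on \<open>J\<close> only the factor of the
  largest node is.\<close>

lemma ex_sign_split:
  assumes "k \<ge> 1"
  shows "\<exists>I j0 J. {..3*k+1} = insert j0 (I \<union> J) \<and> card I = 2*k \<and> card J = k+1 \<and>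
    j0 \<notin> I \<and> j0 \<notin> J \<and> I \<inter> J = {} \<and> (\<Prod>i\<in>I. x j0 - x i) > 0 \<and> (\<forall>j\<in>J. (\<Prod>i\<in>I. x j - x i) < 0)"
proof -
  have neq: "x i \<noteq> x j" if "i \<le> 3*k+1" "j \<le> 3*k+1" "i \<noteq> j" for i j
    using inj_onD[OF inj_x, of i j] that by auto
  have "1 \<le> card {..3*k+1}" by simp
  then obtain A where A: "A \<subseteq> {..3*k+1}" "card A = 1" "\<And>i j. i \<in> A \<Longrightarrow> j \<in> {..3*k+1} - A \<Longrightarrow> x i \<le> x j"
    using ex_lowest_subset[OF finite_atMost, of 1 "3*k+1" x] by blast
  then obtain a where a: "A = {a}" by (auto simp: card_1_singleton_iff)
  let ?S = "{..3*k+1} - {a}"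
  have "card ?S = 3*k+1" using A a by simp
  then have "finite ?S" "3*k \<le> card ?S" by auto
  then obtain B where B: "B \<subseteq> ?S" "card B = 3*k" "\<And>i j. i \<in> B \<Longrightarrow> j \<in> ?S - B \<Longrightarrow> x i \<le> x j"
    using ex_lowest_subset[of ?S "3*k" x] by blast
  have "finite B" using B(1) finite_subset by blast
  have "card (?S - B) = 1" using B \<open>card ?S = 3*k+1\<close> \<open>finite B\<close> by (subst card_Diff_subset) auto
  then obtain b where b: "?S - B = {b}" by (auto simp: card_1_singleton_iff)
  have "2*k-1 \<le> card B" using B(2) by simp
  then obtain I where I: "I \<subseteq> B" "card I = 2*k-1" "\<And>i j. i \<in> I \<Longrightarrow> j \<in> B - I \<Longrightarrow> x i \<le> x j"
    using ex_lowest_subset[OF \<open>finite B\<close>, of "2*k-1" x] by blast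
  have "finite I" using I(1) \<open>finite B\<close> finite_subset by blast
  have bB: "b \<notin> B" "b \<le> 3*k+1" "b \<noteq> a" using b by auto
  have aB: "a \<notin> B" "a \<le> 3*k+1" using B(1) A(1) a by auto
  have B_le: "i \<le> 3*k+1" if "i \<in> B" for i using B(1) that by auto
  have pos: "(\<Prod>i\<in>insert b I. x a - x i) > 0"
  proof -
    have neg: "x a - x i < 0" if "i \<in> insert b I" for i
    proof -
      have "i \<le> 3*k+1" "i \<noteq> a" using that bB aB I(1) B_le by auto
      then show ?thesis using A(3)[of a i] neq[of a i] aB a by auto
    qed
    have "(\<Prod>i\<in>insert b I. x a - x i) = (\<Prod>i\<in>insert b I. (-1) * (x i - x a))" by simp
    also have "\<dots> = (-1) ^ card (insert b I) * (\<Prod>i\<in>insert b I. x i - x a)"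
      by (simp only: prod.distrib prod_constant)
    also have "card (insert b I) = 2*k" using I bB \<open>finite I\<close> assms by (subst card_insert_disjoint) auto
    finally have "(\<Prod>i\<in>insert b I. x a - x i) = (\<Prod>i\<in>insert b I. x i - x a)" by simp
    also have "\<dots> > 0" using neg by (intro prod_pos) auto
    finally show ?thesis .
  qed
  have neg: "(\<Prod>i\<in>insert b I. x j - x i) < 0" if j: "j \<in> B - I" for j
  proof -
    have "b \<in> ?S - B" unfolding b by simp
    then have "x j \<le> x b" using B(3)[of j b] j by blast
    moreover have "x j \<noteq> x b" using B_le[of j] j bB by (intro neq) auto
    ultimately have "x j < x b" by simp
    moreover have "(\<Prod>i\<in>I. x j - x i) > 0"
    proof (rule prod_pos)
      fix i assume i: "i \<in> I"
      then have "x i \<le> x j" "i \<noteq> j" "i \<in> B" using I j by auto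
      then show "0 < x j - x i" using neq[of i j] B_le[of i] B_le[of j] j by auto
    qed
    ultimately have "(x j - x b) * (\<Prod>i\<in>I. x j - x i) < 0" by (simp add: mult_neg_pos)
    then show ?thesis using bB I(1) \<open>finite I\<close> by (subst prod.insert) auto
  qed
  show ?thesis
  proof (rule exI[of _ "insert b I"], rule exI[of _ a], rule exI[of _ "B - I"], intro conjI ballI)
    show "{..3*k+1} = insert a (insert b I \<union> (B - I))" using b I(1) aB B(1) bB by auto
    show "card (insert b I) = 2*k" using I bB \<open>finite I\<close> assms by (subst card_insert_disjoint) auto
    show "card (B - I) = k+1" using I B \<open>finite I\<close> assms by (subst card_Diff_subset) auto
    show "a \<notin> insert b I" using aB bB I(1) by auto
    show "insert b I \<inter> (B - I) = {}" using bB by auto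
  qed (use pos neg aB in auto)
qed

text \<open>Take \<open>P = (\<Prod>i\<in>I. x - x\<^sub>i)\<close> with \<open>I\<close>, \<open>J\<close>, \<open>j0\<close> as in \<open>ex_sign_split\<close>. If the determinant
  vanishes at \<open>Y\<close> over \<open>P\<close>, then \<open>Y q = r\<close> at the nodes; as \<open>r\<close> vanishes on \<open>I\<close>, it is a multiple
  of \<open>P\<close>, so \<open>Y\<close> is a multiple of \<open>q\<close> on \<open>J\<close> and at \<open>j0\<close>. But \<open>Y\<close> is imaginary on the \<open>k+1\<close> nodes
  of \<open>J\<close> and real, nonzero at \<open>j0\<close>.\<close>

lemma ex_good_values:
  assumes "k \<ge> 1"
  shows "\<exists>Z. (\<forall>i\<le>k. chk i Z = 0) \<and>
    (\<forall>Y. (\<forall>j\<le>3*k+1. (Y j)\<^sup>2 = Z j) \<longrightarrow> det (chk_mat Y) \<noteq> 0)"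
proof -
  obtain I j0 J where split: "{..3*k+1} = insert j0 (I \<union> J)" "card I = 2*k" "card J = k+1"
    "j0 \<notin> I" "j0 \<notin> J" "I \<inter> J = {}" "(\<Prod>i\<in>I. x j0 - x i) > 0" "\<And>j. j \<in> J \<Longrightarrow> (\<Prod>i\<in>I. x j - x i) < 0"
    using ex_sign_split[OF assms] by blast
  have "finite (insert j0 (I \<union> J))" unfolding split(1)[symmetric] by simp
  then have fin: "finite I" "finite J" by auto
  have sub: "I \<subseteq> {..3*k+1}" "J \<subseteq> {..3*k+1}" "j0 \<le> 3*k+1" using split(1) by auto
  define P where "P = (\<Prod>i\<in>I. [:- X i, 1:])"
  have "P \<noteq> 0" by (auto simp: P_def fin)
  have degP: "degree P = 2*k"
    unfolding P_def by (subst degree_prod_eq_sum_degree) (auto simp: split(2))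
  have polyP: "poly P (X j) = of_rat (\<Prod>i\<in>I. x j - x i)" for j
    by (simp add: P_def poly_prod of_rat_prod of_rat_diff X_def)
  have P_I: "poly P (X j) = 0" if "j \<in> I" for j
    using that fin unfolding polyP by auto
  have "det (chk_mat Y) \<noteq> 0" if Y: "\<forall>j\<le>3*k+1. (Y j)\<^sup>2 = poly P (X j)" for Y
  proof
    assume "det (chk_mat Y) = 0"
    then obtain q where q: "q \<noteq> 0" "degree q \<le> k" "\<forall>i\<le>k. chk i (\<lambda>j. Y j * poly q (X j)) = 0"
      unfolding det_chk_mat_eq_0_iff by blast
    then obtain r where r: "degree r \<le> 2*k" "\<And>j. j \<le> 3*k+1 \<Longrightarrow> Y j * poly q (X j) = poly r (X j)"
      using chk_zero_iff[of "\<lambda>j. Y j * poly q (X j)"] by blast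
    \<comment> \<open>\<open>P\<close> is monic of degree 2k, so subtracting \<open>c\<close> times
      \<open>P\<close> lowers the degree of \<open>r\<close> below 2k, while the 2k zeros in
      \<open>I\<close> remain.\<close>
    define c where "c = coeff r (2*k)"
    have rP: "r = smult c P"
    proof (rule ccontr)
      assume ne: "r \<noteq> smult c P"
      have "lead_coeff P = 1" unfolding P_def by (simp add: lead_coeff_prod)
      then have "coeff (r - smult c P) (2*k) = 0" using degP by (simp add: c_def)
      moreover have "degree (r - smult c P) \<le> 2*k"
        by (rule degree_diff_le[OF r(1)]) (use degP degree_smult_le[of c P] in simp)
      ultimately have "degree (r - smult c P) < 2*k"
        using ne by (metis eq_iff_diff_eq_0 le_neq_implies_less leading_coeff_0_iff)
      then have "r - smult c P = 0"
      proof (intro poly_eq_of_card_nodes[of X I])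
        fix j assume "j \<in> I"
        then have "Y j = 0" "poly P (X j) = 0" "j \<le> 3*k+1" using Y P_I sub by auto
        then show "poly (r - smult c P) (X j) = poly 0 (X j)" using r(2)[of j] by simp
      qed (use split(2) fin inj_on_subset[OF inj_X sub(1)] assms in auto)
      then show False using ne by simp
    qed
    have qY: "poly q (X j) = c * Y j" if "j \<in> insert j0 J" for j
    proof -
      have j: "j \<le> 3*k+1" "poly P (X j) \<noteq> 0"
        using that sub split(7) split(8)[of j] by (auto simp: polyP)
      then have "Y j \<noteq> 0" using Y by auto
      moreover have "Y j * poly q (X j) = c * (Y j)\<^sup>2"
        using r(2)[OF j(1)] Y j(1) by (simp add: rP)
      ultimately show ?thesis by (simp add: power2_eq_square)
    qed
    have "c \<noteq> 0"
    proof
      assume "c = 0"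
      have "q = 0"
        by (rule poly_eq_of_card_nodes[of X J])
          (use qY \<open>c = 0\<close> q(2) fin split(3) inj_on_subset[OF inj_X sub(2)] in \<open>auto simp: less_Suc_eq_le\<close>)
      then show False using q(1) by simp
    qed
    define h where "h = smult (1 / c) q"
    have hY: "poly h (X j) = Y j" if "j \<in> insert j0 J" for j
      using qY[OF that] \<open>c \<noteq> 0\<close> by (simp add: h_def)
    have "Re (poly h (X j0)) = 0"
    proof (rule real_part_poly[OF _ sub(2) split(3)])
      show "degree h \<le> k" unfolding h_def by (rule order.trans[OF degree_smult_le q(2)])
      fix j assume j: "j \<in> J"
      then have "(Y j)\<^sup>2 = of_rat (\<Prod>i\<in>I. x j - x i)" using Y sub polyP[of j] by auto
      then have "(Y j)\<^sup>2 = of_real (of_rat (\<Prod>i\<in>I. x j - x i))" by (simp add: of_real_of_rat)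
      then have "Re ((Y j)\<^sup>2) = of_rat (\<Prod>i\<in>I. x j - x i)" "Im ((Y j)\<^sup>2) = 0" by simp_all
      then have "(Re (Y j))\<^sup>2 - (Im (Y j))\<^sup>2 < 0" "2 * Re (Y j) * Im (Y j) = 0"
        using split(8)[OF j] by (simp_all add: Re_power2 Im_power2)
      then have "Re (Y j) = 0" by auto
      then show "Re (poly h (X j)) = 0" using hY j by simp
    qed
    then have "Re (Y j0) = 0" using hY by simp
    moreover have "(Y j0)\<^sup>2 = of_real (of_rat (\<Prod>i\<in>I. x j0 - x i))"
      using Y sub polyP[of j0] by (simp add: of_real_of_rat)
    then have "Re ((Y j0)\<^sup>2) = of_rat (\<Prod>i\<in>I. x j0 - x i)" by simp
    then have "Re ((Y j0)\<^sup>2) > 0" using split(7) by simp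
    ultimately show False by (simp add: Re_power2)
  qed
  moreover have "\<forall>i\<le>k. chk i (\<lambda>j. poly P (X j)) = 0" using chk_poly degP by simp
  ultimately show ?thesis by blast
qed

section \<open>Projection from the linear subspace and its inverse\<close>

text \<open>The error at node \<open>k+1+j\<close> of extrapolating from the nodes 0 to k. The
  common zeros for \<open>j\<close> up to 2k are L, so these are the coordinates of the projection
  from L.\<close>

definition proj_form :: "nat \<Rightarrow> qpoly" where
  "proj_form j = pvar (k+1+j) - (\<Sum>l\<le>k. pconst (lag x k l (x (k+1+j))) * pvar l)"

text \<open>A linear section of the projection: each class modulo L is represented by the vector
  that is 0 at the first k+1 nodes.\<close>

definition lift_form :: "nat \<Rightarrow> qpoly" where
  "lift_form j = (if j \<le> k then 0 else pvar (j - (k+1)))"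

text \<open>The parameter is \<open>lift_form\<close> in the inverse map, and \<open>pvar\<close>
  where the determinant is needed as a polynomial function of \<open>Y\<close>.\<close>

definition mat_form :: "(nat \<Rightarrow> qpoly) \<Rightarrow> qpoly mat" where
  "mat_form L = mat (k+1) (k+1)
     (\<lambda>(i, b). \<Sum>j\<le>3*k+1. pconst (chk_coeff i j * x j ^ b) * L j)"

text \<open>For \<open>Y = lift z\<close>, the point \<open>s Y + q\<close> lies on \<open>W\<close> iff \<open>2 chk i (Y q) = - s chk i (Y\<^sup>2)\<close> for all
  \<open>i\<close>; \<open>shift_form\<close> are the coefficients of \<open>q\<close> for \<open>s = det\<close>.\<close>

definition shift_form :: "nat \<Rightarrow> qpoly" where
  "shift_form b = (\<Sum>i<k+1. adj_mat (mat_form lift_form) $$ (b, i) *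
     (pconst (- 1 / 2) * (\<Sum>j\<le>3*k+1. pconst (chk_coeff i j) * (lift_form j * lift_form j))))"

text \<open>The leading factor \<open>det\<close> is redundant as a rational map; it makes the base locus equal to
  the zero locus of the determinant.\<close>

definition inv_form :: "nat \<Rightarrow> qpoly" where
  "inv_form j = det (mat_form lift_form) *
     (det (mat_form lift_form) * lift_form j + (\<Sum>b\<le>k. pconst (x j ^ b) * shift_form b))"

definition proj_vec :: "(nat \<Rightarrow> complex) \<Rightarrow> nat \<Rightarrow> complex" where
  "proj_vec Y j = Y (k+1+j) - (\<Sum>l\<le>k. Y l * lag X k l (X (k+1+j)))"

definition lift_vec :: "(nat \<Rightarrow> complex) \<Rightarrow> nat \<Rightarrow> complex" where
  "lift_vec z j = (if j \<le> k then 0 else z (j - (k+1)))"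

lemma peval_proj_form: "peval (proj_form j) v = proj_vec v j"
  by (simp add: proj_form_def proj_vec_def peval_hom.hom_minus peval_sum peval_mult of_rat_lag mult.commute)

lemma peval_lift_form: "peval (lift_form j) v = lift_vec v j"
  by (simp add: lift_form_def lift_vec_def)

lemma mat_form_carrier: "mat_form L \<in> carrier_mat (k+1) (k+1)"
  by (simp add: mat_form_def)

lemma map_mat_peval_mat_form:
  "map_mat (\<lambda>p. peval p v) (mat_form L) = chk_mat (\<lambda>j. peval (L j) v)"
  by (rule eq_matI)
    (simp_all add: mat_form_def chk_mat_def chk_def peval_sum peval_mult of_rat_mult of_rat_power X_def
      mult_ac del: sum.atMost_Suc)

lemma peval_det_mat_form: "peval (det (mat_form L)) v = det (chk_mat (\<lambda>j. peval (L j) v))"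
  unfolding map_mat_peval_mat_form[symmetric] by (rule peval_hom.hom_det[symmetric])

lemma polyfun_det_chk_mat: "polyfun (\<lambda>v. det (chk_mat v))"
  using polyfun_peval[of "det (mat_form pvar)"] by (simp add: peval_det_mat_form[abs_def])

lemma polyfun_det_chk_mat_lift: "polyfun (\<lambda>z. det (chk_mat (lift_vec z)))"
proof -
  have "(\<lambda>j. peval (lift_form j) z) = lift_vec z" for z
    by (rule ext) (rule peval_lift_form)
  then show ?thesis
    using polyfun_peval[of "det (mat_form lift_form)"] by (simp add: peval_det_mat_form[abs_def])
qed

lemma inj_X_k: "inj_on X {..k}"
  by (rule inj_on_subset[OF inj_X]) auto

lemma proj_vec_poly: "degree q \<le> k \<Longrightarrow> proj_vec (\<lambda>j. poly q (X j)) j = 0"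
  unfolding proj_vec_def by (simp only: poly_lagrange[OF inj_X_k, symmetric] diff_self)

lemma proj_vec_lift_add:
  assumes "degree q \<le> k"
  shows "proj_vec (\<lambda>j. c * (d * lift_vec z j + poly q (X j))) j = c * d * z j"
proof -
  have "proj_vec (\<lambda>j. c * (d * lift_vec z j + poly q (X j))) j
      = c * d * z j + c * proj_vec (\<lambda>j. poly q (X j)) j"
    unfolding proj_vec_def lift_vec_def by (simp add: sum_distrib_left algebra_simps)
  then show ?thesis by (simp only: proj_vec_poly[OF assms] mult_zero_right add_0_right)
qed

lemma proj_decomposition:
  "Y j = lift_vec (proj_vec Y) j + poly (interp X k Y) (X j)"
proof (cases "j \<le> k")
  case True
  then show ?thesis by (simp add: lift_vec_def poly_interp_node[OF inj_X_k])
next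
  case False
  then have "k + 1 + (j - (k+1)) = j" by simp
  then show ?thesis using False by (simp only: lift_vec_def proj_vec_def poly_interp) simp
qed

text \<open>Both vectors agree modulo L. Hence the open conditions on W and on the target of the
  projection correspond to each other.\<close>

lemma chk_mat_lift_proj: "chk_mat (lift_vec (proj_vec Y)) = chk_mat Y"
  by (rule chk_mat_shift[symmetric, OF degree_interp proj_decomposition])

definition shift_poly :: "(nat \<Rightarrow> complex) \<Rightarrow> complex poly" where
  "shift_poly z = poly_of_coeffs (\<lambda>b. peval (shift_form b) z) k"

lemma degree_shift_poly: "degree (shift_poly z) \<le> k"
  unfolding shift_poly_def by (rule degree_poly_of_coeffs)

lemma peval_inv_form:
  "peval (inv_form j) z = det (chk_mat (lift_vec z)) *
     (det (chk_mat (lift_vec z)) * lift_vec z j + poly (shift_poly z) (X j))"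
proof -
  have lift: "(\<lambda>j. peval (lift_form j) z) = lift_vec z"
    by (rule ext) (rule peval_lift_form)
  show ?thesis
    by (simp add: inv_form_def peval_mult peval_add peval_sum peval_det_mat_form lift peval_lift_form
        shift_poly_def poly_poly_of_coeffs X_def of_rat_power mult.commute)
qed

text \<open>\<open>A\<close> is the adjugate, formed over \<open>qpoly\<close> and then evaluated.
  The identity with \<open>A\<close> on the right shows that \<open>shift_poly\<close> solves the
  scaled system, the one with \<open>A\<close> on the left that it is the only candidate; neither
  divides by the determinant.\<close>

lemma coeff_vec_shift_poly:
  obtains A where "A \<in> carrier_mat (k+1) (k+1)"
    "chk_mat (lift_vec z) * A = det (chk_mat (lift_vec z)) \<cdot>\<^sub>m 1\<^sub>m (k+1)"
    "A * chk_mat (lift_vec z) = det (chk_mat (lift_vec z)) \<cdot>\<^sub>m 1\<^sub>m (k+1)"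
    "coeff_vec (shift_poly z) =
       A *\<^sub>v vec (k+1) (\<lambda>i. (- 1 / 2) * chk i (\<lambda>j. (lift_vec z j)\<^sup>2))"
proof -
  let ?h = "\<lambda>p. peval p z" and ?M = "mat_form lift_form"
  have lift: "(\<lambda>j. peval (lift_form j) z) = lift_vec z"
    by (rule ext) (rule peval_lift_form)
  have M: "map_mat ?h ?M = chk_mat (lift_vec z)"
    by (simp add: map_mat_peval_mat_form lift)
  have d: "?h (det ?M) = det (chk_mat (lift_vec z))"
    by (simp add: peval_det_mat_form lift)
  note adj = adj_mat[OF mat_form_carrier, of lift_form]
  have smult: "map_mat ?h (det ?M \<cdot>\<^sub>m 1\<^sub>m (k+1)) = det (chk_mat (lift_vec z)) \<cdot>\<^sub>m 1\<^sub>m (k+1)"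
    by (rule eq_matI) (auto simp: d[symmetric] peval_mult)
  show ?thesis
  proof (rule that[of "map_mat ?h (adj_mat ?M)"])
    show "map_mat ?h (adj_mat ?M) \<in> carrier_mat (k+1) (k+1)" using adj(1) by simp
    show "chk_mat (lift_vec z) * map_mat ?h (adj_mat ?M) = det (chk_mat (lift_vec z)) \<cdot>\<^sub>m 1\<^sub>m (k+1)"
      unfolding M[symmetric] peval_hom.mat_hom_mult[OF mat_form_carrier adj(1), symmetric] adj(2)
      using smult M by simp
    show "map_mat ?h (adj_mat ?M) * chk_mat (lift_vec z) = det (chk_mat (lift_vec z)) \<cdot>\<^sub>m 1\<^sub>m (k+1)"
      unfolding M[symmetric] peval_hom.mat_hom_mult[OF adj(1) mat_form_carrier, symmetric] adj(3)
      using smult M by simp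
    show "coeff_vec (shift_poly z) = map_mat ?h (adj_mat ?M) *\<^sub>v
        vec (k+1) (\<lambda>i. (- 1 / 2) * chk i (\<lambda>j. (lift_vec z j)\<^sup>2))"
    proof (rule eq_vecI)
      fix b assume "b < dim_vec (map_mat ?h (adj_mat ?M) *\<^sub>v
        vec (k+1) (\<lambda>i. (- 1 / 2) * chk i (\<lambda>j. (lift_vec z j)\<^sup>2)))"
      then have b: "b < k+1" using adj(1) by simp
      have C: "peval (\<Sum>j\<le>3*k+1. pconst (chk_coeff i j) * (lift_form j * lift_form j)) z
          = chk i (\<lambda>j. (lift_vec z j)\<^sup>2)" for i
        unfolding chk_def peval_sum
        by (rule sum.cong) (simp_all add: peval_mult peval_lift_form power2_eq_square)
      have "peval (shift_form b) z = (\<Sum>i<k+1. peval (adj_mat ?M $$ (b, i)) z *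
          ((- 1 / 2) * chk i (\<lambda>j. (lift_vec z j)\<^sup>2)))"
        unfolding shift_form_def
        by (subst peval_sum, intro sum.cong refl, simp only: peval_mult C)
          (simp add: of_rat_divide of_rat_minus)
      then show "coeff_vec (shift_poly z) $ b = (map_mat ?h (adj_mat ?M) *\<^sub>v
          vec (k+1) (\<lambda>i. (- 1 / 2) * chk i (\<lambda>j. (lift_vec z j)\<^sup>2))) $ b"
        using b adj(1)
        by (auto simp: coeff_vec_def shift_poly_def coeff_poly_of_coeffs scalar_prod_def
            lessThan_atLeast0 intro!: sum.cong)
    qed (use adj(1) in \<open>simp add: coeff_vec_def\<close>)
  qed
qed

lemma chk_lift_shift_poly:
  assumes "i \<le> k"
  shows "chk i (\<lambda>j. lift_vec z j * poly (shift_poly z) (X j)) =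
    det (chk_mat (lift_vec z)) * ((- 1 / 2) * chk i (\<lambda>j. (lift_vec z j)\<^sup>2))"
proof -
  let ?r = "vec (k+1) (\<lambda>i. (- 1 / 2) * chk i (\<lambda>j. (lift_vec z j)\<^sup>2))"
  obtain A where A: "A \<in> carrier_mat (k+1) (k+1)"
    "chk_mat (lift_vec z) * A = det (chk_mat (lift_vec z)) \<cdot>\<^sub>m 1\<^sub>m (k+1)"
    "coeff_vec (shift_poly z) = A *\<^sub>v ?r"
    using coeff_vec_shift_poly by blast
  have r: "?r \<in> carrier_vec (k+1)" by simp
  have "vec (k+1) (\<lambda>i. chk i (\<lambda>j. lift_vec z j * poly (shift_poly z) (X j)))
      = chk_mat (lift_vec z) *\<^sub>v (A *\<^sub>v ?r)"
    unfolding A(3)[symmetric] by (rule chk_mat_mult_coeff_vec[OF degree_shift_poly, symmetric])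
  also have "\<dots> = (det (chk_mat (lift_vec z)) \<cdot>\<^sub>m 1\<^sub>m (k+1)) *\<^sub>v ?r"
    unfolding A(2)[symmetric] by (rule assoc_mult_mat_vec[OF chk_mat_carrier A(1) r, symmetric])
  also have "\<dots> = det (chk_mat (lift_vec z)) \<cdot>\<^sub>v (1\<^sub>m (k+1) *\<^sub>v ?r)"
    by (rule smult_mat_mult_vec[OF one_carrier_mat r])
  also have "\<dots> = det (chk_mat (lift_vec z)) \<cdot>\<^sub>v ?r" by (simp only: one_mult_mat_vec[OF r])
  finally have "vec (k+1) (\<lambda>i. chk i (\<lambda>j. lift_vec z j * poly (shift_poly z) (X j))) $ i
      = (det (chk_mat (lift_vec z)) \<cdot>\<^sub>v ?r) $ i" by (simp only:)
  then show ?thesis using assms by simp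
qed

lemma shift_poly_unique:
  assumes "degree q \<le> k"
    and "\<And>i. i \<le> k \<Longrightarrow> chk i (\<lambda>j. lift_vec z j * poly q (X j)) = (- 1 / 2) * chk i (\<lambda>j. (lift_vec z j)\<^sup>2)"
  shows "shift_poly z = smult (det (chk_mat (lift_vec z))) q"
proof -
  let ?r = "vec (k+1) (\<lambda>i. (- 1 / 2) * chk i (\<lambda>j. (lift_vec z j)\<^sup>2))"
  obtain A where A: "A \<in> carrier_mat (k+1) (k+1)"
    "A * chk_mat (lift_vec z) = det (chk_mat (lift_vec z)) \<cdot>\<^sub>m 1\<^sub>m (k+1)"
    "coeff_vec (shift_poly z) = A *\<^sub>v ?r"
    using coeff_vec_shift_poly by blast
  have "?r = chk_mat (lift_vec z) *\<^sub>v coeff_vec q"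
    unfolding chk_mat_mult_coeff_vec[OF assms(1)] by (rule eq_vecI) (simp_all add: assms(2))
  then have "coeff_vec (shift_poly z) = A *\<^sub>v (chk_mat (lift_vec z) *\<^sub>v coeff_vec q)"
    by (simp only: A(3))
  also have "\<dots> = (det (chk_mat (lift_vec z)) \<cdot>\<^sub>m 1\<^sub>m (k+1)) *\<^sub>v coeff_vec q"
    unfolding A(2)[symmetric]
    by (rule assoc_mult_mat_vec[OF A(1) chk_mat_carrier coeff_vec_carrier, symmetric])
  also have "\<dots> = det (chk_mat (lift_vec z)) \<cdot>\<^sub>v (1\<^sub>m (k+1) *\<^sub>v coeff_vec q)"
    by (rule smult_mat_mult_vec[OF one_carrier_mat coeff_vec_carrier])
  also have "\<dots> = det (chk_mat (lift_vec z)) \<cdot>\<^sub>v coeff_vec q"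
    by (simp only: one_mult_mat_vec[OF coeff_vec_carrier])
  finally have eq: "coeff_vec (shift_poly z) = det (chk_mat (lift_vec z)) \<cdot>\<^sub>v coeff_vec q" .
  show ?thesis
  proof (rule poly_eqI)
    fix b
    show "coeff (shift_poly z) b = coeff (smult (det (chk_mat (lift_vec z))) q) b"
    proof (cases "b \<le> k")
      case True
      have "coeff_vec (shift_poly z) $ b = (det (chk_mat (lift_vec z)) \<cdot>\<^sub>v coeff_vec q) $ b"
        by (simp only: eq)
      then show ?thesis using True by (simp add: coeff_vec_def)
    next
      case False
      then show ?thesis using degree_shift_poly[of z] assms(1) by (simp add: coeff_eq_0)
    qed
  qed
qed

text \<open>In the expanded square the term \<open>?s * ?s\<close> has degree at most 2k and is
  killed; the mixed term cancels the square of the lift by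
  \<open>chk_lift_shift_poly\<close>.\<close>

lemma chk_inv_form_square:
  assumes "i \<le> k"
  shows "chk i (\<lambda>j. (peval (inv_form j) z)\<^sup>2) = 0"
proof -
  let ?d = "det (chk_mat (lift_vec z))" and ?s = "shift_poly z" and ?Y = "lift_vec z"
  have "(peval (inv_form j) z)\<^sup>2 = ?d ^ 4 * (?Y j)\<^sup>2
      + (2 * ?d ^ 3 * (?Y j * poly ?s (X j)) + ?d\<^sup>2 * poly (?s * ?s) (X j))" for j
    unfolding peval_inv_form poly_mult
    by (simp add: power2_eq_square power3_eq_cube power4_eq_xxxx algebra_simps)
  then have "chk i (\<lambda>j. (peval (inv_form j) z)\<^sup>2) = ?d ^ 4 * chk i (\<lambda>j. (?Y j)\<^sup>2)
      + (2 * ?d ^ 3 * chk i (\<lambda>j. ?Y j * poly ?s (X j)) + ?d\<^sup>2 * chk i (\<lambda>j. poly (?s * ?s) (X j)))"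
    by (simp only: chk_add chk_scale)
  also have "chk i (\<lambda>j. poly (?s * ?s) (X j)) = 0"
    using degree_mult_le[of ?s ?s] degree_shift_poly[of z] assms by (intro chk_poly) auto
  finally show ?thesis unfolding chk_lift_shift_poly[OF assms]
    by (simp add: power2_eq_square power3_eq_cube power4_eq_xxxx)
qed

text \<open>Split \<open>Y\<close> into its lifted projection and the interpolant \<open>q\<close>
  at the first k+1 nodes. The equations of W for \<open>Y\<close> say exactly that \<open>q\<close>
  solves the linear system, so \<open>shift_poly\<close> is \<open>det\<close> times
  \<open>q\<close>; the leading factor of \<open>inv_form\<close> gives the second
  \<open>det\<close>.\<close>

lemma inv_form_proj:
  assumes "\<forall>i\<le>k. chk i (\<lambda>j. (Y j)\<^sup>2) = 0"
  shows "peval (inv_form j) (proj_vec Y) = (det (chk_mat Y))\<^sup>2 * Y j"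
proof -
  let ?z = "proj_vec Y" and ?q = "interp X k Y"
  have deg: "degree ?q \<le> k" by (rule degree_interp)
  have "shift_poly ?z = smult (det (chk_mat (lift_vec ?z))) ?q"
  proof (rule shift_poly_unique[OF deg])
    fix i assume i: "i \<le> k"
    have "(Y j)\<^sup>2 = (lift_vec ?z j)\<^sup>2 + (2 * (lift_vec ?z j * poly ?q (X j)) + poly (?q * ?q) (X j))" for j
      using proj_decomposition[of Y j] by (simp add: power2_eq_square algebra_simps)
    then have "chk i (\<lambda>j. (Y j)\<^sup>2) = chk i (\<lambda>j. (lift_vec ?z j)\<^sup>2)
        + (2 * chk i (\<lambda>j. lift_vec ?z j * poly ?q (X j)) + chk i (\<lambda>j. poly (?q * ?q) (X j)))"
      by (simp only: chk_add chk_scale)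
    moreover have "chk i (\<lambda>j. poly (?q * ?q) (X j)) = 0"
      using degree_mult_le[of ?q ?q] deg i by (intro chk_poly) auto
    ultimately have "chk i (\<lambda>j. (lift_vec ?z j)\<^sup>2) + 2 * chk i (\<lambda>j. lift_vec ?z j * poly ?q (X j)) = 0"
      using assms i by simp
    then show "chk i (\<lambda>j. lift_vec ?z j * poly ?q (X j)) = (- 1 / 2) * chk i (\<lambda>j. (lift_vec ?z j)\<^sup>2)"
      by (simp add: field_simps add_eq_0_iff)
  qed
  then have "peval (inv_form j) ?z = (det (chk_mat Y))\<^sup>2 * (lift_vec ?z j + poly ?q (X j))"
    unfolding peval_inv_form chk_mat_lift_proj by (simp add: power2_eq_square algebra_simps)
  then show ?thesis by (simp only: proj_decomposition[symmetric])
qed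

lemma proj_inv_form: "proj_vec (\<lambda>j. peval (inv_form j) z) j = (det (chk_mat (lift_vec z)))\<^sup>2 * z j"
  unfolding peval_inv_form proj_vec_lift_add[OF degree_shift_poly] by (simp add: power2_eq_square)

lemma is_form_proj_form:
  assumes "j \<le> 2*k"
  shows "is_form (3*k+1) 1 (proj_form j)"
  unfolding proj_form_def
proof (intro is_form_diff is_form_sum)
  show "is_form (3*k+1) 1 (pvar (k+1+j))" using assms by (intro is_form_pvar) auto
  fix l assume "l \<in> {..k}"
  then have "is_form (3*k+1) (0 + 1) (pconst (lag x k l (x (k+1+j))) * pvar l)"
    by (intro is_form_mult is_form_pconst is_form_pvar) auto
  then show "is_form (3*k+1) 1 (pconst (lag x k l (x (k+1+j))) * pvar l)" by simp
qed

lemma is_form_lift_form: "j \<le> 3*k+1 \<Longrightarrow> is_form (2*k) 1 (lift_form j)"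
  using is_form_pvar[of "j - (k+1)" "2*k"] by (auto simp: lift_form_def is_form_zero)

lemma is_form_mat_form_entry:
  assumes "r < k+1" "c < k+1"
  shows "is_form (2*k) 1 (mat_form lift_form $$ (r, c))"
proof -
  have "is_form (2*k) (0 + 1) (\<Sum>j\<le>3*k+1. pconst (chk_coeff r j * x j ^ c) * lift_form j)"
    by (intro is_form_sum is_form_mult is_form_pconst is_form_lift_form) auto
  then show ?thesis using assms by (simp add: mat_form_def del: sum.atMost_Suc)
qed

lemma is_form_inv_form:
  assumes "j \<le> 3*k+1"
  shows "is_form (2*k) ((k+1) + (k+2)) (inv_form j)"
proof -
  have "is_form (2*k) (\<Sum>r<k+1. 1) (det (mat_form lift_form))"
    by (rule is_form_det[OF mat_form_carrier is_form_mat_form_entry])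
  then have D: "is_form (2*k) (k+1) (det (mat_form lift_form))" by simp
  \<comment> \<open>The unsimplified degree mirrors the nesting of products, so that
    \<open>is_form_mult\<close> applies: k from the adjugate, 1 + 1 from the squared lift, 0 from
    constants.\<close>
  have S: "is_form (2*k) (0 + (k + (0 + (0 + (1 + 1))))) (pconst (x j ^ b) * shift_form b)" if "b \<le> k" for b
    unfolding shift_form_def
  proof (intro is_form_mult is_form_pconst is_form_sum is_form_lift_form)
    fix i assume "i \<in> {..<k+1}"
    then have "is_form (2*k) ((k + 1 - 1) * 1) (adj_mat (mat_form lift_form) $$ (b, i))"
      using that by (intro is_form_adj_mat[OF mat_form_carrier] is_form_mat_form_entry) auto
    then show "is_form (2*k) k (adj_mat (mat_form lift_form) $$ (b, i))" by simp
  qed auto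
  have "is_form (2*k) (k+2) (\<Sum>b\<le>k. pconst (x j ^ b) * shift_form b)"
    by (rule is_form_sum) (use S in simp)
  moreover have "is_form (2*k) ((k+1)+1) (det (mat_form lift_form) * lift_form j)"
    by (intro is_form_mult D is_form_lift_form assms)
  ultimately have "is_form (2*k) (k+2) (det (mat_form lift_form) * lift_form j
      + (\<Sum>b\<le>k. pconst (x j ^ b) * shift_form b))"
    by (intro is_form_add) simp_all
  then show ?thesis unfolding inv_form_def by (rule is_form_mult[OF D])
qed

section \<open>Dense open sets and the birational equivalence\<close>

lemma quadric_intersection_subset: "quadric_intersection k x \<subseteq> proj_space (3*k+1)"
  by (auto simp: quadric_intersection_def zero_locus_def)

text \<open>Kept general in \<open>D\<close>, since \<open>rational_map\<close> and
  \<open>left_inverse_map\<close> ask for density of different sets, both containing the locus where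
  the determinant is nonzero.\<close>

lemma dense_in_quadric_intersection:
  assumes "k \<ge> 1" "D \<subseteq> quadric_intersection k x"
    and D: "\<And>v. \<lbrakk>v \<in> hvec (3*k+1); ppoint_of v \<in> quadric_intersection k x; det (chk_mat v) \<noteq> 0\<rbrakk>
      \<Longrightarrow> ppoint_of v \<in> D"
  shows "proj_dense_in (3*k+1) D (quadric_intersection k x)"
proof (rule proj_dense_inI[OF quadric_intersection_subset assms(2)])
  fix d f v
  assume van: "\<And>w. w \<in> hvec (3*k+1) \<Longrightarrow> ppoint_of w \<in> D \<Longrightarrow> peval f w = 0"
    and v: "v \<in> hvec (3*k+1)" "ppoint_of v \<in> quadric_intersection k x"
  obtain Z where Z: "\<And>i. i \<le> k \<Longrightarrow> chk i Z = 0"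
    "\<And>Y. (\<forall>j\<le>3*k+1. (Y j)\<^sup>2 = Z j) \<Longrightarrow> det (chk_mat Y) \<noteq> 0"
    using ex_good_values[OF assms(1)] by blast
  show "peval f v = 0"
  \<comment> \<open>The coordinates run from 0 to 3k+1, hence \<open>n = 3*k+2\<close>.\<close>
  proof (rule vanish_by_square_path[OF polyfun_peval polyfun_det_chk_mat, where n = "3*k+2" and Z = Z])
    fix t Y
    assume Y: "\<forall>j<3*k+2. (Y j)\<^sup>2 = (v j)\<^sup>2 + t * (Z j - (v j)\<^sup>2)" "\<forall>j\<ge>3*k+2. Y j = 0"
      "det (chk_mat Y) \<noteq> 0"
    have hY: "Y \<in> hvec (3*k+1)" using det_chk_mat_nonzero_imp[OF Y(3)] Y(2) by (auto simp: hvec_def)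
    have "chk i (\<lambda>j. (Y j)\<^sup>2) = 0" if i: "i \<le> k" for i
    proof -
      have "chk i (\<lambda>j. (Y j)\<^sup>2) = chk i (\<lambda>j. (1 - t) * (v j)\<^sup>2 + t * Z j)"
        by (rule chk_cong) (use Y(1) in \<open>auto simp: algebra_simps\<close>)
      also have "\<dots> = (1 - t) * chk i (\<lambda>j. (v j)\<^sup>2) + t * chk i Z"
        by (simp only: chk_add chk_scale)
      also have "\<dots> = 0" using Z(1)[OF i] v mem_quadric_intersection[OF v(1)] i by simp
      finally show ?thesis .
    qed
    then have "ppoint_of Y \<in> D" using D[OF hY] Y(3) mem_quadric_intersection[OF hY] by blast
    then show "peval f Y = 0" by (rule van[OF hY])
  qed (use Z(2) v(1) in \<open>auto simp: hvec_def\<close>)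
qed

text \<open>The determinant is nonzero somewhere on the target: any choice of roots of the good
  values can be projected there. Straight lines to that point suffice, as no equations have to be
  respected.\<close>

lemma dense_in_proj_space:
  assumes "k \<ge> 1" "D \<subseteq> proj_space (2*k)"
    and D: "\<And>z. \<lbrakk>z \<in> hvec (2*k); det (chk_mat (lift_vec z)) \<noteq> 0\<rbrakk> \<Longrightarrow> ppoint_of z \<in> D"
  shows "proj_dense_in (2*k) D (proj_space (2*k))"
proof (rule proj_dense_inI[OF subset_refl assms(2)])
  fix d f z
  assume van: "\<And>w. w \<in> hvec (2*k) \<Longrightarrow> ppoint_of w \<in> D \<Longrightarrow> peval f w = 0"
    and z: "z \<in> hvec (2*k)"
  obtain Z where Z: "\<And>Y. (\<forall>j\<le>3*k+1. (Y j)\<^sup>2 = Z j) \<Longrightarrow> det (chk_mat Y) \<noteq> 0"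
    using ex_good_values[OF assms(1)] by blast
  define Y where "Y = (\<lambda>j. if j \<le> 3*k+1 then csqrt (Z j) else 0)"
  have "det (chk_mat Y) \<noteq> 0" by (rule Z) (simp add: Y_def)
  then have Y: "det (chk_mat (lift_vec (proj_vec Y))) \<noteq> 0" by (simp add: chk_mat_lift_proj)
  \<comment> \<open>Vectors in \<open>hvec\<close> vanish beyond 2k; \<open>lift_vec\<close> reads
    only coordinates up to 2k at the nodes, so the truncation keeps the matrix.\<close>
  define w where "w = (\<lambda>j. if j \<le> 2*k then proj_vec Y j else 0)"
  have "chk_mat (lift_vec w) = chk_mat (lift_vec (proj_vec Y))"
    by (rule chk_mat_shift[of 0]) (auto simp: lift_vec_def w_def)
  then have w: "det (chk_mat (lift_vec w)) \<noteq> 0" using Y by simp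
  show "peval f z = 0"
  proof (rule vanish_by_line[OF polyfun_peval polyfun_det_chk_mat_lift w])
    fix t
    let ?u = "\<lambda>i. z i + t * (w i - z i)"
    assume u: "det (chk_mat (lift_vec ?u)) \<noteq> 0"
    then obtain j where "lift_vec ?u j \<noteq> 0" using det_chk_mat_nonzero_imp by blast
    then have "?u (j - (k+1)) \<noteq> 0" unfolding lift_vec_def by presburger
    moreover have "?u i = 0" if "i > 2*k" for i using z that by (simp add: hvec_def w_def)
    ultimately have "?u \<in> hvec (2*k)" unfolding hvec_def by blast
    then show "peval f ?u = 0" using van D u by blast
  qed
qed

lemma map_vec_proj_form: "map_vec (2*k) proj_form v = (\<lambda>j. if j \<le> 2*k then proj_vec v j else 0)"
  by (auto simp: map_vec_def peval_proj_form)

lemma det_chk_mat_lift_map_vec: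
  "det (chk_mat (lift_vec (map_vec (2*k) proj_form v))) = det (chk_mat v)"
proof -
  have "chk_mat (lift_vec (map_vec (2*k) proj_form v)) = chk_mat (lift_vec (proj_vec v))"
    by (rule chk_mat_shift[of 0]) (auto simp: lift_vec_def map_vec_proj_form)
  then show ?thesis by (simp add: chk_mat_lift_proj)
qed

lemma map_vec_proj_form_hvec:
  assumes "det (chk_mat v) \<noteq> 0"
  shows "map_vec (2*k) proj_form v \<in> hvec (2*k)"
proof -
  let ?z = "map_vec (2*k) proj_form v"
  obtain j where "lift_vec ?z j \<noteq> 0"
    using det_chk_mat_nonzero_imp[of "lift_vec ?z"] assms det_chk_mat_lift_map_vec by auto
  then have "?z (j - (k+1)) \<noteq> 0" unfolding lift_vec_def by presburger
  moreover have "?z i = 0" if "i > 2*k" for i using that by (simp add: map_vec_def)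
  ultimately show ?thesis unfolding hvec_def by blast
qed

lemma map_vec_inv_proj:
  assumes v: "v \<in> hvec (3*k+1)" "ppoint_of v \<in> quadric_intersection k x"
  shows "map_vec (3*k+1) inv_form (map_vec (2*k) proj_form v) = (\<lambda>j. (det (chk_mat v))\<^sup>2 * v j)"
proof
  fix j
  show "map_vec (3*k+1) inv_form (map_vec (2*k) proj_form v) j = (det (chk_mat v))\<^sup>2 * v j"
  proof (cases "j \<le> 3*k+1")
    case True
    have "peval (inv_form j) (map_vec (2*k) proj_form v) = peval (inv_form j) (proj_vec v)"
      by (rule peval_cong[OF is_form_inv_form[OF True]]) (simp add: map_vec_proj_form)
    also have "\<dots> = (det (chk_mat v))\<^sup>2 * v j"
      using inv_form_proj v mem_quadric_intersection[OF v(1)] by blast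
    finally show ?thesis using True by (simp add: map_vec_def)
  next
    case False
    then show ?thesis using v(1) by (auto simp: map_vec_def hvec_def)
  qed
qed

lemma map_vec_proj_inv:
  assumes "z \<in> hvec (2*k)"
  shows "map_vec (2*k) proj_form (map_vec (3*k+1) inv_form z)
    = (\<lambda>j. (det (chk_mat (lift_vec z)))\<^sup>2 * z j)"
proof
  fix j
  show "map_vec (2*k) proj_form (map_vec (3*k+1) inv_form z) j
      = (det (chk_mat (lift_vec z)))\<^sup>2 * z j"
  proof (cases "j \<le> 2*k")
    case True
    have "peval (proj_form j) (map_vec (3*k+1) inv_form z)
        = peval (proj_form j) (\<lambda>j. peval (inv_form j) z)"
      by (rule peval_cong[OF is_form_proj_form[OF True]]) (simp add: map_vec_def)
    then show ?thesis using True by (simp add: map_vec_def peval_proj_form proj_inv_form)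
  next
    case False
    then show ?thesis using assms by (auto simp: map_vec_def hvec_def)
  qed
qed

text \<open>The leading determinant in \<open>inv_form\<close> gives one direction. For the other,
  projecting the image back returns a nonzero multiple of \<open>z\<close>, so the image is
  nonzero.\<close>

lemma map_vec_inv_form_hvec_iff:
  assumes "z \<in> hvec (2*k)"
  shows "map_vec (3*k+1) inv_form z \<in> hvec (3*k+1) \<longleftrightarrow> det (chk_mat (lift_vec z)) \<noteq> 0"
proof
  assume *: "map_vec (3*k+1) inv_form z \<in> hvec (3*k+1)"
  show "det (chk_mat (lift_vec z)) \<noteq> 0"
  proof
    assume "det (chk_mat (lift_vec z)) = 0"
    then have "map_vec (3*k+1) inv_form z = (\<lambda>_. 0)" by (auto simp: map_vec_def peval_inv_form)
    then show False using * by (simp add: hvec_def)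
  qed
next
  assume d: "det (chk_mat (lift_vec z)) \<noteq> 0"
  obtain j where "z j \<noteq> 0" using assms by (auto simp: hvec_def)
  then have ne: "map_vec (2*k) proj_form (map_vec (3*k+1) inv_form z) j \<noteq> 0"
    unfolding map_vec_proj_inv[OF assms] using d by simp
  have "\<exists>i. map_vec (3*k+1) inv_form z i \<noteq> 0"
  proof (rule ccontr)
    assume "\<not> ?thesis"
    then have "map_vec (3*k+1) inv_form z = (\<lambda>_. 0)" by auto
    then show False using ne by (simp add: map_vec_proj_form proj_vec_def split: if_splits)
  qed
  then show "map_vec (3*k+1) inv_form z \<in> hvec (3*k+1)" by (auto simp: hvec_def map_vec_def)
qed

lemma map_vec_inv_form_mem:
  assumes "map_vec (3*k+1) inv_form z \<in> hvec (3*k+1)"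
  shows "ppoint_of (map_vec (3*k+1) inv_form z) \<in> quadric_intersection k x"
  unfolding mem_quadric_intersection[OF assms]
proof (intro allI impI)
  fix i assume "i \<le> k"
  have "chk i (\<lambda>j. (map_vec (3*k+1) inv_form z j)\<^sup>2) = chk i (\<lambda>j. (peval (inv_form j) z)\<^sup>2)"
    by (rule chk_cong) (simp add: map_vec_def)
  then show "chk i (\<lambda>j. (map_vec (3*k+1) inv_form z j)\<^sup>2) = 0"
    using chk_inv_form_square[OF \<open>i \<le> k\<close>] by simp
qed

text \<open>\<open>left_inverse_map\<close> demands the identity wherever the composite is defined,
  not only generically. Definedness of \<open>inv_form\<close> means a nonzero determinant, and
  there both composites are multiplication by its square.\<close>

lemma birational_quadric_intersection:
  assumes k: "k \<ge> 1"
  shows "birational (3*k+1) (quadric_intersection k x) (2*k) (proj_space (2*k))"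
proof -
  let ?n = "3*k+1" and ?m = "2*k" and ?W = "quadric_intersection k x"
  let ?F = "map_vec (2*k) proj_form" and ?G = "map_vec (3*k+1) inv_form"
  have appF: "map_app ?m proj_form (ppoint_of v) = ppoint_of (?F v)" for v
    by (rule map_app_ppoint_of) (rule is_form_proj_form)
  have appG: "map_app ?n inv_form (ppoint_of z) = ppoint_of (?G z)" for z
    by (rule map_app_ppoint_of) (rule is_form_inv_form)
  have domF: "ppoint_of v \<in> map_dom ?m proj_form V \<longleftrightarrow> ppoint_of v \<in> V \<and> ?F v \<in> hvec ?m" for v V
    by (rule ppoint_of_mem_map_dom) (rule is_form_proj_form)
  have domG: "ppoint_of z \<in> map_dom ?n inv_form V \<longleftrightarrow> ppoint_of z \<in> V \<and> ?G z \<in> hvec ?n" for z V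
    by (rule ppoint_of_mem_map_dom) (rule is_form_inv_form)
  have PI: "ppoint_of z \<in> proj_space m" if "z \<in> hvec m" for z m
    using that by (simp add: proj_space_def)
  have rep_W: "\<exists>v\<in>hvec ?n. P = ppoint_of v" if "P \<in> ?W" for P
    using that quadric_intersection_subset by (auto simp: proj_space_def)
  have rep_P: "\<exists>z\<in>hvec ?m. P = ppoint_of z" if "P \<in> proj_space ?m" for P
    using that by (auto simp: proj_space_def)
  have domF_sub: "map_dom ?m proj_form ?W \<subseteq> ?W" by (auto simp: map_dom_def)
  have domG_sub: "map_dom ?n inv_form (proj_space ?m) \<subseteq> proj_space ?m" by (auto simp: map_dom_def)
  have FG: "?F (?G z) \<in> hvec ?m" if "z \<in> hvec ?m" "det (chk_mat (lift_vec z)) \<noteq> 0" for z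
    unfolding map_vec_proj_inv[OF that(1)] by (rule hvec_scale) (use that in simp_all)
  have FG_point: "ppoint_of (?F (?G z)) = ppoint_of z"
    if "z \<in> hvec ?m" "det (chk_mat (lift_vec z)) \<noteq> 0" for z
    unfolding map_vec_proj_inv[OF that(1)] by (rule ppoint_of_scale) (use that in simp)
  have GF_point: "ppoint_of (?G (?F v)) = ppoint_of v"
    if "v \<in> hvec ?n" "ppoint_of v \<in> ?W" "det (chk_mat v) \<noteq> 0" for v
    unfolding map_vec_inv_proj[OF that(1,2)] by (rule ppoint_of_scale) (use that in simp)
  have "rational_map ?n ?W ?m (proj_space ?m) proj_form"
    unfolding rational_map_def
  proof (intro conjI ballI)
    show "\<exists>d. \<forall>j\<le>?m. is_form ?n d (proj_form j)" using is_form_proj_form by blast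
    show "proj_dense_in ?n (map_dom ?m proj_form ?W) ?W"
      by (rule dense_in_quadric_intersection[OF k domF_sub]) (simp only: domF map_vec_proj_form_hvec simp_thms)
    fix P assume P: "P \<in> map_dom ?m proj_form ?W"
    obtain v where v: "P = ppoint_of v" using rep_W P domF_sub by blast
    then have "?F v \<in> hvec ?m" using P domF by blast
    then show "map_app ?m proj_form P \<in> proj_space ?m" unfolding v appF by (rule PI)
  qed
  moreover have "rational_map ?m (proj_space ?m) ?n ?W inv_form"
    unfolding rational_map_def
  proof (intro conjI ballI)
    show "\<exists>d. \<forall>j\<le>?n. is_form ?m d (inv_form j)" using is_form_inv_form by blast
    show "proj_dense_in ?m (map_dom ?n inv_form (proj_space ?m)) (proj_space ?m)"
      by (rule dense_in_proj_space[OF k domG_sub]) (simp only: domG map_vec_inv_form_hvec_iff PI simp_thms not_False_eq_True)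
    fix P assume P: "P \<in> map_dom ?n inv_form (proj_space ?m)"
    obtain z where z: "P = ppoint_of z" using rep_P P domG_sub by blast
    then have "?G z \<in> hvec ?n" using P domG by blast
    then show "map_app ?n inv_form P \<in> ?W" unfolding z appG by (rule map_vec_inv_form_mem)
  qed
  moreover have "left_inverse_map ?n ?W ?m (proj_space ?m) inv_form proj_form"
    unfolding left_inverse_map_def
  proof (intro conjI ballI impI)
    show "proj_dense_in ?n {P \<in> map_dom ?m proj_form ?W.
        map_app ?m proj_form P \<in> map_dom ?n inv_form (proj_space ?m)} ?W"
    proof (rule dense_in_quadric_intersection[OF k])
      fix v assume v: "v \<in> hvec ?n" "ppoint_of v \<in> ?W" "det (chk_mat v) \<noteq> 0"
      have F: "?F v \<in> hvec ?m" by (rule map_vec_proj_form_hvec[OF v(3)])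
      have "?G (?F v) \<in> hvec ?n"
        using map_vec_inv_form_hvec_iff[OF F] v(3) det_chk_mat_lift_map_vec by simp
      then show "ppoint_of v \<in> {P \<in> map_dom ?m proj_form ?W.
          map_app ?m proj_form P \<in> map_dom ?n inv_form (proj_space ?m)}"
        using F v(2) PI[OF F] by (simp only: mem_Collect_eq domF appF domG simp_thms)
    qed (use domF_sub in blast)
    fix P assume P: "P \<in> map_dom ?m proj_form ?W"
      and "map_app ?m proj_form P \<in> map_dom ?n inv_form (proj_space ?m)"
    obtain v where v: "v \<in> hvec ?n" "P = ppoint_of v" using rep_W P domF_sub by blast
    have F: "?F v \<in> hvec ?m" using P domF v(2) by blast
    have "?G (?F v) \<in> hvec ?n"
      using \<open>map_app ?m proj_form P \<in> _\<close> unfolding v(2) appF domG by blast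
    then have "det (chk_mat v) \<noteq> 0"
      using map_vec_inv_form_hvec_iff[OF F] det_chk_mat_lift_map_vec by simp
    then show "map_app ?n inv_form (map_app ?m proj_form P) = P"
      unfolding v(2) appF appG using v P domF_sub by (intro GF_point) auto
  qed
  moreover have "left_inverse_map ?m (proj_space ?m) ?n ?W proj_form inv_form"
    unfolding left_inverse_map_def
  proof (intro conjI ballI impI)
    show "proj_dense_in ?m {P \<in> map_dom ?n inv_form (proj_space ?m).
        map_app ?n inv_form P \<in> map_dom ?m proj_form ?W} (proj_space ?m)"
    proof (rule dense_in_proj_space[OF k])
      fix z assume z: "z \<in> hvec ?m" "det (chk_mat (lift_vec z)) \<noteq> 0"
      then have G: "?G z \<in> hvec ?n" using map_vec_inv_form_hvec_iff by blast
      show "ppoint_of z \<in> {P \<in> map_dom ?n inv_form (proj_space ?m).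
          map_app ?n inv_form P \<in> map_dom ?m proj_form ?W}"
        using G PI[OF z(1)] map_vec_inv_form_mem[OF G] FG[OF z]
        by (simp only: mem_Collect_eq domF appG domG simp_thms)
    qed (use domG_sub in blast)
    fix P assume P: "P \<in> map_dom ?n inv_form (proj_space ?m)"
    obtain z where z: "z \<in> hvec ?m" "P = ppoint_of z" using rep_P P domG_sub by blast
    have "?G z \<in> hvec ?n" using P domG z(2) by blast
    then have "det (chk_mat (lift_vec z)) \<noteq> 0" using map_vec_inv_form_hvec_iff[OF z(1)] by blast
    then show "map_app ?m proj_form (map_app ?n inv_form P) = P"
      unfolding z(2) appF appG by (rule FG_point[OF z(1)])
  qed
  ultimately show ?thesis unfolding birational_def by blast
qed

end

theorem theorem5p1:
  fixes k :: nat and x :: "nat \<Rightarrow> rat"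
  assumes "k \<ge> 1"
    and "inj_on x {0..3*k+1}"
  shows "rational_variety (3*k+1) (quadric_intersection k x)"
proof -
  interpret nodes k x
    using assms(2) by unfold_locales (simp add: atLeast0AtMost)
  have "birational (3*k+1) (quadric_intersection k x) (2*k) (proj_space (2*k))"
    using assms(1) by (rule birational_quadric_intersection)
  moreover have "2*k \<ge> 1" using assms(1) by simp
  ultimately show ?thesis
    unfolding rational_variety_def using proj_closed_quadric_intersection by blast
qed

end
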